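(* Let $T>0$, let $p:[0,T]\to(1,\infty)$ be continuous with $p(0)=p(T)$, let $\theta:\mathbb{R}\to\mathbb{R}$ be continuous, and let $e\in L^1([0,T];\mathbb{R})$ satisfy $\int_0^T e(t)\,dt=0$. For $\varepsilon>0$ consider the problem $$(\phi_{p(t)}(u'))'+\theta(u)u'-\varepsilon u=e(t)\ \text{ in }[0,T],\qquad u(0)-u(T)=0=u'(0)-u'(T).\qquad (P_\varepsilon)$$ For any $\varepsilon^*>0$ there exists $R=R(\varepsilon^* )>0$ such that, for all $\varepsilon\in(0,\varepsilon^*]$, problem $(P_\varepsilon)$ has at least one solution in $B(0,R)$, and any solution $u$ of $(P_\varepsilon)$ belongs to $B(0,R)$ and satisfies $\overline{u}=0$.
   Context: For $t\in[0,T]$ and $x\in\mathbb{R}$, $\phi_{p(t)}(x)=|x|^{p(t)-2}x$ (with $\phi_{p(t)}(0)=0$). $C^1_T$ is the space of $C^1$ functions $v:[0,T]\to\mathbb{R}$ with $v(0)=v(T)$ and $v'(0)=v'(T)$, normed by $\|v\|_1=\|v\|_\infty+\|v'\|_\infty$ (sup-norms); $B(0,R)$ is the open ball of radius $R$ centered at $0$ in $C^1_T$. For $v\in L^1([0,T];\mathbb{R})$, $\overline{v}:=\frac1T\int_0^T v(t)\,dt$. A solution of $(P_\varepsilon)$ is a function $u\in C^1_T$ such that $t\mapsto\phi_{p(t)}(u'(t))$ is absolutely continuous on $[0,T]$ and the differential equation holds for almost every $t\in[0,T]$. *)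

theory Defs
  imports "HOL-Analysis.Analysis"
begin

text \<open>Functions on the interval from 0 to T are total functions on the reals of which only the values
  on the interval matter.  In particular derivatives are taken within the interval, hence are
  one-sided at its endpoints.\<close>

definition ideriv :: "real \<Rightarrow> (real \<Rightarrow> real) \<Rightarrow> real \<Rightarrow> real" where
  "ideriv T u t = vector_derivative u (at t within {0..T})"

text \<open>No separate clause is needed for \<open>x = 0\<close>: the second factor makes the value 0 there.\<close>

definition phi :: "real \<Rightarrow> real \<Rightarrow> real" where
  "phi q x = \<bar>x\<bar> powr (q - 2) * x"

definition C1T :: "real \<Rightarrow> (real \<Rightarrow> real) set" where
  "C1T T = {u. u differentiable_on {0..T} \<and> continuous_on {0..T} (ideriv T u) \<and>
               u 0 = u T \<and> ideriv T u 0 = ideriv T u T}"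

definition C1T_norm :: "real \<Rightarrow> (real \<Rightarrow> real) \<Rightarrow> real" where
  "C1T_norm T u = (SUP t\<in>{0..T}. \<bar>u t\<bar>) + (SUP t\<in>{0..T}. \<bar>ideriv T u t\<bar>)"

definition C1T_ball :: "real \<Rightarrow> real \<Rightarrow> (real \<Rightarrow> real) set" where
  "C1T_ball T R = {u \<in> C1T T. C1T_norm T u < R}"

definition mean :: "real \<Rightarrow> (real \<Rightarrow> real) \<Rightarrow> real" where
  "mean T v = (1 / T) * (LINT t:{0..T}|lebesgue. v t)"

text \<open>Absolute continuity of a function; \<^const>\<open>absolutely_continuous\<close> is the notion for measures.\<close>

definition abs_continuous_on_interval :: "real \<Rightarrow> real \<Rightarrow> (real \<Rightarrow> real) \<Rightarrow> bool" where
  "abs_continuous_on_interval c d f \<longleftrightarrow>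
    (\<forall>\<eta>>0. \<exists>\<delta>>0. \<forall>(n::nat) a b.
       (\<forall>i<n. c \<le> a i \<and> a i \<le> b i \<and> b i \<le> d) \<and>
       disjoint_family_on (\<lambda>i. {a i<..<b i}) {..<n} \<and>
       (\<Sum>i<n. b i - a i) < \<delta> \<longrightarrow>
       (\<Sum>i<n. \<bar>f (b i) - f (a i)\<bar>) < \<eta>)"

text \<open>The periodic boundary conditions are part of membership in \<^const>\<open>C1T\<close>.\<close>

definition is_solution ::
  "real \<Rightarrow> (real \<Rightarrow> real) \<Rightarrow> (real \<Rightarrow> real) \<Rightarrow> (real \<Rightarrow> real) \<Rightarrow> real \<Rightarrow> (real \<Rightarrow> real) \<Rightarrow> bool" where
  "is_solution T p \<theta> e \<epsilon> u \<longleftrightarrow>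
     u \<in> C1T T \<and>
     abs_continuous_on_interval 0 T (\<lambda>t. phi (p t) (ideriv T u t)) \<and>
     (AE t\<in>{0..T} in lebesgue. \<exists>d.
        ((\<lambda>s. phi (p s) (ideriv T u s)) has_real_derivative d) (at t within {0..T}) \<and>
        d + \<theta> (u t) * ideriv T u t - \<epsilon> * u t = e t)"

end

theory Submission
  imports Defs "HOL-Complex_Analysis.Great_Picard"
begin

text \<open>
Write \<open>E(t)\<close> for the integral of \<open>e\<close> from 0 to \<open>t\<close> and let \<open>\<Theta>' = \<theta>\<close>.  The function
\<open>w = \<phi>\<^sub>p(u') + \<Theta>(u) - E\<close> turns the problem into a planar system
\<open>w' = \<epsilon> u\<close>, \<open>\<phi>\<^sub>p(u') = w + E(t) - \<Theta>(u)\<close>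
in which only continuous functions occur; the boundary conditions say that \<open>(w, u)\<close> is periodic, because
\<open>E(0) = E(T) = 0\<close> and \<open>p(0) = p(T)\<close>.  Passing from a solution to this system is the
fundamental theorem of calculus for absolutely continuous functions (\<open>FTC_abs_continuous\<close>); passing
back needs that an indefinite integral is absolutely continuous and differentiable almost everywhere
with the right derivative (\<open>abs_continuous_indefinite_integral\<close>,
\<open>indefinite_integral_has_derivative_ae\<close>).  Since \<open>\<epsilon> u = w'\<close> and \<open>w\<close> is periodic, \<open>u\<close> has mean zero.

A priori bounds.  Multiply the second equation by \<open>u'\<close> and integrate over a period: \<open>\<Theta>(u) u'\<close>
contributes 0, \<open>w u'\<close> contributes the integral of \<open>-\<epsilon> u\<^sup>2\<close>, and so the integral of
\<open>|u'|\<^sup>p\<close> is at most \<open>M = sup |E|\<close> times that of \<open>|u'|\<close>.  As \<open>p\<close> is bounded away from 1, this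
bounds the integral of \<open>|u'|\<close>, and then \<open>u\<close> itself, because \<open>u\<close> vanishes somewhere
(\<open>energy_bound\<close>).  The bound does not contain \<open>\<epsilon>\<close>.  At a zero of \<open>u'\<close> the second equation bounds
\<open>w\<close>; the slope of \<open>w\<close> is at most \<open>\<epsilon> sup |u|\<close>, so \<open>w\<close> is bounded on the whole interval,
uniformly for \<open>\<epsilon> \<le> \<epsilon>\<^sup>*\<close>, and the second equation bounds \<open>u'\<close>.

Existence.  Solve the second equation for \<open>u'\<close> with the inverse of \<open>\<phi>\<^sub>p\<close>, and cut off the values of
\<open>u\<close> and \<open>w\<close> on the right-hand sides.  The field becomes bounded and continuous, and pushes \<open>w\<close> in
the direction of \<open>u\<close> and, for large \<open>|w|\<close>, pushes \<open>u\<close> in the direction of \<open>w\<close>.  Every such field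
has a periodic orbit (\<open>planar_periodic_solution\<close>): for delayed equations, whose solutions
are continuous in the initial value even if the field is merely continuous, this is the
Poincare-Miranda theorem for the displacement over one period, and the delay is removed with the theorem of Arzela and Ascoli.
The same a priori bounds hold for the cut-off system, so its periodic orbit never meets the cut-offs
and solves the original problem.
\<close>

section \<open>Absolutely continuous functions and indefinite integrals\<close>

text \<open>The families of intervals in the definition of absolute continuity are indexed by initial segments
of the natural numbers.  The cells of a tagged division come as an arbitrary finite set, so the
condition is transported along an enumeration.\<close>

lemma abs_continuous_finite_family:
  assumes ac: "abs_continuous_on_interval c d f" and "\<eta> > 0"
  shows "\<exists>\<delta>>0. \<forall>(I::'i set) lo hi.
     finite I \<and> (\<forall>i\<in>I. c \<le> lo i \<and> lo i \<le> hi i \<and> hi i \<le> d) \<and>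
     disjoint_family_on (\<lambda>i. {lo i<..<hi i}) I \<and> (\<Sum>i\<in>I. hi i - lo i) < \<delta> \<longrightarrow>
     (\<Sum>i\<in>I. \<bar>f (hi i) - f (lo i)\<bar>) < \<eta>"
proof -
  obtain \<delta> where "\<delta> > 0" and \<delta>: "\<And>(n::nat) a b.
       (\<forall>i<n. c \<le> a i \<and> a i \<le> b i \<and> b i \<le> d) \<and>
       disjoint_family_on (\<lambda>i. {a i<..<b i}) {..<n} \<and>
       (\<Sum>i<n. b i - a i) < \<delta> \<Longrightarrow>
       (\<Sum>i<n. \<bar>f (b i) - f (a i)\<bar>) < \<eta>"
    using ac \<open>\<eta> > 0\<close> unfolding abs_continuous_on_interval_def by meson
  have "(\<Sum>i\<in>I. \<bar>f (hi i) - f (lo i)\<bar>) < \<eta>"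
    if I: "finite I" "\<And>i. i \<in> I \<Longrightarrow> c \<le> lo i \<and> lo i \<le> hi i \<and> hi i \<le> d"
      "disjoint_family_on (\<lambda>i. {lo i<..<hi i}) I" "(\<Sum>i\<in>I. hi i - lo i) < \<delta>"
    for I :: "'i set" and lo hi
  proof -
    obtain h where h: "bij_betw h {..<card I} I"
      using ex_bij_betw_nat_finite[OF I(1)] by (auto simp: atLeast0LessThan)
    have inj: "inj_on h {..<card I}" and im: "h ` {..<card I} = I"
      using h by (auto simp: bij_betw_def)
    have mem: "h i \<in> I" if "i < card I" for i
      using im that by blast
    have "disjoint_family_on (\<lambda>i. {lo (h i)<..<hi (h i)}) {..<card I}"
      unfolding disjoint_family_on_def
    proof (intro ballI impI)
      fix i j assume "i \<in> {..<card I}" "j \<in> {..<card I}" "i \<noteq> j"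
      then have "h i \<in> I" "h j \<in> I" "h i \<noteq> h j"
        using mem inj by (auto simp: inj_on_eq_iff)
      then show "{lo (h i)<..<hi (h i)} \<inter> {lo (h j)<..<hi (h j)} = {}"
        using I(3) unfolding disjoint_family_on_def by blast
    qed
    moreover have "(\<Sum>i<card I. hi (h i) - lo (h i)) = (\<Sum>i\<in>I. hi i - lo i)"
      using sum.reindex_bij_betw[OF h] .
    ultimately have "(\<Sum>i<card I. \<bar>f (hi (h i)) - f (lo (h i))\<bar>) < \<eta>"
      using \<delta>[of "card I" "lo \<circ> h" "hi \<circ> h"] I(2,4) mem by simp
    then show ?thesis
      using sum.reindex_bij_betw[OF h, of "\<lambda>i. \<bar>f (hi i) - f (lo i)\<bar>"] by simp
  qed
  then show ?thesis using \<open>\<delta> > 0\<close> by (intro exI[of _ \<delta>]) simp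
qed

text \<open>The Henstock-Kurzweil integral permits a direct proof.  Choose a gauge that is controlled by
differentiability off the null set \<open>N\<close>, and at a point of \<open>N\<close> keeps the cell inside an open set \<open>U \<supseteq> N\<close>
of measure below the \<open>\<delta>\<close> of absolute continuity.  In the telescoping sum for \<open>f b - f a\<close> the cells
tagged outside \<open>N\<close> reproduce the Riemann sum up to a small multiple of their length, and the cells
tagged in \<open>N\<close> contribute little because their total length is small.\<close>

lemma FTC_abs_continuous:
  fixes f g :: "real \<Rightarrow> real"
  assumes "a \<le> b" and ac: "abs_continuous_on_interval a b f" and N: "negligible N"
    and deriv: "\<And>x. x \<in> {a..b} - N \<Longrightarrow> (f has_real_derivative g x) (at x within {a..b})"
  shows "(g has_integral (f b - f a)) {a..b}"
proof -
  \<comment> \<open>Changing the integrand on a null set does not change its integral; with the value 0 the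
      tags in it drop out of the Riemann sums.\<close>
  define g0 where "g0 x = (if x \<in> N then 0 else g x)" for x
  have "(g0 has_integral (f b - f a)) {a..b}"
    unfolding has_integral_real
  proof (intro allI impI)
    fix e :: real assume "e > 0"
    \<comment> \<open>The summand 1 keeps the denominator positive when the interval is a point.\<close>
    define e1 where "e1 = e / (2 * (b - a + 1))"
    have "e1 > 0" using \<open>e > 0\<close> \<open>a \<le> b\<close> by (simp add: e1_def)
    obtain \<delta> where "\<delta> > 0" and \<delta>: "\<forall>(I::(real \<times> real set) set) lo hi.
          finite I \<and> (\<forall>i\<in>I. a \<le> lo i \<and> lo i \<le> hi i \<and> hi i \<le> b) \<and>
          disjoint_family_on (\<lambda>i. {lo i<..<hi i}) I \<and> (\<Sum>i\<in>I. hi i - lo i) < \<delta>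
          \<longrightarrow> (\<Sum>i\<in>I. \<bar>f (hi i) - f (lo i)\<bar>) < e / 2"
      using abs_continuous_finite_family[OF ac half_gt_zero[OF \<open>e > 0\<close>]] by blast
    have "N \<in> lmeasurable" using N negligible_iff_measure by blast
    obtain U where U: "open U" "N \<subseteq> U" "U - N \<in> lmeasurable" "emeasure lebesgue (U - N) < ennreal \<delta>"
      using sets_lebesgue_outer_open[of N \<delta>] \<open>\<delta> > 0\<close> \<open>N \<in> lmeasurable\<close> by blast
    have "U = (U - N) \<union> N" using U by blast
    with U(3) \<open>N \<in> lmeasurable\<close> have Um: "U \<in> lmeasurable" by (metis fmeasurable.Un)
    have "emeasure lebesgue U = emeasure lebesgue (U - N)"
      using N \<open>U = _\<close> U(3) emeasure_Un_null_set[of "U - N" lebesgue N]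
      by (simp add: negligible_iff_null_sets fmeasurableD)
    then have "ennreal (measure lebesgue U) < ennreal \<delta>"
      using U(4) Um by (simp add: emeasure_eq_measure2)
    then have Ud: "measure lebesgue U < \<delta>"
      by (simp add: ennreal_less_iff)
    have "\<exists>\<gamma>>0. (x \<in> N \<longrightarrow> ball x \<gamma> \<subseteq> U) \<and>
            (x \<in> {a..b} - N \<longrightarrow> (\<forall>y\<in>{a..b}. \<bar>y - x\<bar> < \<gamma> \<longrightarrow>
               \<bar>f y - f x - g x * (y - x)\<bar> \<le> e1 * \<bar>y - x\<bar>))" for x
    proof (cases "x \<in> N")
      case True
      then show ?thesis using U(1,2) open_contains_ball by blast
    next
      case False
      show ?thesis
      proof (cases "x \<in> {a..b}")
        case True
        with False deriv have "(f has_derivative (\<lambda>h. g x * h)) (at x within {a..b})"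
          by (simp add: has_field_derivative_def)
        then obtain \<gamma> where "\<gamma> > 0"
          "\<forall>y\<in>{a..b}. norm (y - x) < \<gamma> \<longrightarrow> norm (f y - f x - g x * (y - x)) \<le> e1 * norm (y - x)"
          using \<open>e1 > 0\<close> unfolding has_derivative_within_alt by blast
        with False show ?thesis by auto
      qed (use False zero_less_one in blast)
    qed
    then obtain \<gamma> where \<gamma>0: "\<And>x. \<gamma> x > 0"
      and \<gamma>N: "\<And>x. x \<in> N \<Longrightarrow> ball x (\<gamma> x) \<subseteq> U"
      and \<gamma>D: "\<And>x y. \<lbrakk>x \<in> {a..b} - N; y \<in> {a..b}; \<bar>y - x\<bar> < \<gamma> x\<rbrakk>
                 \<Longrightarrow> \<bar>f y - f x - g x * (y - x)\<bar> \<le> e1 * \<bar>y - x\<bar>"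
      by metis
    show "\<exists>\<gamma>. gauge \<gamma> \<and> (\<forall>\<D>. \<D> tagged_division_of {a..b} \<and> \<gamma> fine \<D> \<longrightarrow>
            norm ((\<Sum>(x, k)\<in>\<D>. measure lborel k *\<^sub>R g0 x) - (f b - f a)) < e)"
    proof (intro exI conjI allI impI)
      show "gauge (\<lambda>x. ball x (\<gamma> x))" using \<gamma>0 by (rule gauge_ball_dependent[rule_format])
    next
      fix p assume "p tagged_division_of {a..b} \<and> (\<lambda>x. ball x (\<gamma> x)) fine p"
      then have p: "p tagged_division_of {a..b}" and fine: "(\<lambda>x. ball x (\<gamma> x)) fine p" by auto
      note pD = tagged_division_ofD[OF p]
      have fin: "finite p" by (rule pD)
      have K: "\<exists>u v. K = {u..v} \<and> u \<le> x \<and> x \<le> v \<and> a \<le> u \<and> v \<le> b \<and> Inf K = u \<and> Sup K = v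
                 \<and> measure lborel K = v - u \<and> {u..v} \<subseteq> ball x (\<gamma> x)"
        if mem: "(x, K) \<in> p" for x K
      proof -
        obtain u v where uv: "K = {u..v}" using pD(4)[OF mem] by auto
        have "x \<in> K" "K \<subseteq> {a..b}" using pD(2,3)[OF mem] by auto
        moreover have "K \<subseteq> ball x (\<gamma> x)" using fine mem unfolding fine_def by auto
        ultimately show ?thesis using uv by auto
      qed
      let ?D = "\<lambda>(x, K). measure lborel K * g0 x - (f (Sup K) - f (Inf K))"
      let ?p1 = "{(x, K) \<in> p. x \<notin> N}" and ?p2 = "{(x, K) \<in> p. x \<in> N}"
      have "(\<Sum>(x,K)\<in>p. measure lborel K * g0 x) - (f b - f a) = sum ?D p"
        unfolding additive_tagged_division_1[OF \<open>a \<le> b\<close> p, of f, symmetric]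
        by (simp add: sum_subtractf split_def)
      also have "\<dots> = sum ?D ?p1 + sum ?D ?p2"
        using fin by (subst sum.union_disjoint[symmetric]) (auto intro: finite_subset intro!: sum.cong)
      finally have split: "(\<Sum>(x,K)\<in>p. measure lborel K * g0 x) - (f b - f a) = sum ?D ?p1 + sum ?D ?p2" .
      have D1: "\<bar>?D z\<bar> \<le> e1 * (Sup (snd z) - Inf (snd z))" if zp: "z \<in> ?p1" for z
      proof -
        obtain x K where z: "z = (x, K)" "(x, K) \<in> p" "x \<notin> N" using zp by auto
        obtain u v where uv: "K = {u..v}" "u \<le> x" "x \<le> v" "a \<le> u" "v \<le> b" "Inf K = u" "Sup K = v"
                 "measure lborel K = v - u" "{u..v} \<subseteq> ball x (\<gamma> x)" using K[OF z(2)] by blast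
        have x: "x \<in> {a..b} - N" using uv z by auto
        have "u \<in> {u..v}" "v \<in> {u..v}" using uv by auto
        then have "u \<in> ball x (\<gamma> x)" "v \<in> ball x (\<gamma> x)" using uv(9) by blast+
        then have "\<bar>f u - f x - g x * (u - x)\<bar> \<le> e1 * \<bar>u - x\<bar>" "\<bar>f v - f x - g x * (v - x)\<bar> \<le> e1 * \<bar>v - x\<bar>"
          using \<gamma>D[OF x, of u] \<gamma>D[OF x, of v] uv by (auto simp: dist_real_def)
        moreover have "(v - u) * g x - (f v - f u)
            = (f u - f x - g x * (u - x)) - (f v - f x - g x * (v - x))"
          by (simp add: algebra_simps)
        moreover have "e1 * \<bar>u - x\<bar> + e1 * \<bar>v - x\<bar> = e1 * (v - u)"
          using uv(2,3) by (simp add: algebra_simps)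
        ultimately have "\<bar>(v - u) * g x - (f v - f u)\<bar> \<le> e1 * (v - u)" by linarith
        then show ?thesis using uv z by (simp add: g0_def)
      qed
      have "\<bar>sum ?D ?p1\<bar> \<le> (\<Sum>z\<in>?p1. e1 * (Sup (snd z) - Inf (snd z)))"
        by (rule order_trans[OF sum_abs sum_mono]) (rule D1)
      also have "\<dots> \<le> (\<Sum>z\<in>p. e1 * (Sup (snd z) - Inf (snd z)))"
      proof (rule sum_mono2[OF fin])
        fix z assume "z \<in> p - ?p1"
        then have "z \<in> p" by auto
        with K[of "fst z" "snd z"] show "0 \<le> e1 * (Sup (snd z) - Inf (snd z))"
          using \<open>e1 > 0\<close> by auto
      qed auto
      also have "\<dots> = e1 * (b - a)"
        using additive_tagged_division_1[OF \<open>a \<le> b\<close> p, of "\<lambda>x. x"]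
        by (simp add: split_def flip: sum_distrib_left)
      also have "\<dots> \<le> e / 2" using \<open>e > 0\<close> \<open>a \<le> b\<close> by (simp add: e1_def field_simps)
      finally have s1: "\<bar>sum ?D ?p1\<bar> \<le> e / 2" .
      have part2: "?p2 tagged_partial_division_of {a..b}"
        by (rule tagged_partial_division_subset[of p]) (use p tagged_division_of_def in auto)
      have tot: "(\<Sum>z\<in>?p2. Sup (snd z) - Inf (snd z)) < \<delta>"
      proof -
        have "(\<Sum>z\<in>?p2. Sup (snd z) - Inf (snd z)) = (\<Sum>z\<in>?p2. measure lborel (snd z))"
          using K by (intro sum.cong) fastforce+
        also have "\<dots> = (\<Sum>K\<in>snd ` ?p2. measure lborel K)"
          using sum.over_tagged_division_lemma[OF tagged_partial_division_of_Union_self[OF part2], of "measure lborel"]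
          by (simp add: split_def)
        also have "\<dots> = (\<Sum>K\<in>snd ` ?p2. measure lebesgue K)"
        proof (rule sum.cong[OF refl])
          fix L assume "L \<in> snd ` ?p2"
          then obtain x where "(x, L) \<in> p" by auto
          from K[OF this] obtain u v where "L = {u..v}" by blast
          then show "measure lborel L = measure lebesgue L" by simp
        qed
        also have "\<dots> = measure lebesgue (\<Union>(snd ` ?p2))"
          by (rule content_division[OF division_of_tagged_division[OF
                tagged_partial_division_of_Union_self[OF part2]]])
        also have "\<dots> \<le> measure lebesgue U"
        proof (rule measure_mono_fmeasurable)
          show "\<Union> (snd ` ?p2) \<subseteq> U" using K \<gamma>N by fastforce
          have "closed (\<Union> (snd ` ?p2))"
            using K fin by (intro closed_Union) (auto intro: finite_subset, metis closed_atLeastAtMost)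
          then show "\<Union> (snd ` ?p2) \<in> sets lebesgue" by auto
        qed (use Um in auto)
        finally show ?thesis using Ud by simp
      qed
      have "(\<Sum>z\<in>?p2. \<bar>f (Sup (snd z)) - f (Inf (snd z))\<bar>) < e / 2"
      proof (rule \<delta>[rule_format], intro conjI ballI)
        show "finite ?p2" using fin by (auto intro: finite_subset)
        show "a \<le> Inf (snd z)" "Inf (snd z) \<le> Sup (snd z)" "Sup (snd z) \<le> b"  if "z \<in> ?p2" for z
          using that K[of "fst z" "snd z"] by auto
        show "(\<Sum>z\<in>?p2. Sup (snd z) - Inf (snd z)) < \<delta>" by (rule tot)
        show "disjoint_family_on (\<lambda>z. {Inf (snd z)<..<Sup (snd z)}) ?p2"
          unfolding disjoint_family_on_def
        proof (intro ballI impI)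
          fix y z assume yz: "y \<in> ?p2" "z \<in> ?p2" "y \<noteq> z"
          have int: "interior (snd z) = {Inf (snd z)<..<Sup (snd z)}" if "z \<in> ?p2" for z
          proof -
            have "(fst z, snd z) \<in> p" using that by auto
            from K[OF this] obtain u v where "snd z = {u..v}" "Inf (snd z) = u" "Sup (snd z) = v"
              by blast
            then show ?thesis by (metis interior_atLeastAtMost_real)
          qed
          have "(fst y, snd y) \<in> p" "(fst z, snd z) \<in> p" "(fst y, snd y) \<noteq> (fst z, snd z)"
            using yz by (auto simp: prod_eq_iff)
          from pD(5)[OF this] show "{Inf (snd y)<..<Sup (snd y)} \<inter> {Inf (snd z)<..<Sup (snd z)} = {}"
            by (simp only: int[OF yz(1)] int[OF yz(2)])
        qed
      qed
      moreover have "\<bar>sum ?D ?p2\<bar> \<le> (\<Sum>z\<in>?p2. \<bar>f (Sup (snd z)) - f (Inf (snd z))\<bar>)"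
        by (rule order_trans[OF sum_abs sum_mono]) (auto simp: g0_def)
      ultimately have "\<bar>sum ?D ?p2\<bar> < e / 2" by linarith
      with s1 split show "norm ((\<Sum>(x, k)\<in>p. measure lborel k *\<^sub>R g0 x) - (f b - f a)) < e"
        by simp
    qed
  qed
  then show ?thesis
    by (rule has_integral_spike[OF N, rotated]) (simp add: g0_def)
qed

text \<open>Split \<open>|f| \<le> n + r\<^sub>n\<close> with \<open>r\<^sub>n = max (|f| - n) 0\<close>.  By dominated convergence the integral of
\<open>r\<^sub>n\<close> over the whole interval is small for some fixed \<open>n\<close>, and the constant \<open>n\<close> contributes at most
\<open>n\<close> times the total length of the small intervals.\<close>

lemma abs_continuous_indefinite_integral:
  fixes f :: "real \<Rightarrow> real"
  assumes f: "f absolutely_integrable_on {c..d}"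
  shows "abs_continuous_on_interval c d (\<lambda>t. integral {c..t} f)"
  unfolding abs_continuous_on_interval_def
proof (intro allI impI)
  fix \<eta> :: real assume "\<eta> > 0"
  define r where "r n x = max (\<bar>f x\<bar> - real n) 0" for n x
  have r_bound: "\<bar>f x\<bar> \<le> real n + r n x" for n x by (simp add: r_def)
  have absf: "(\<lambda>x. \<bar>f x\<bar>) absolutely_integrable_on {c..d}"
    using absolutely_integrable_norm[OF f] by (simp add: o_def)
  have r_abs: "r n absolutely_integrable_on {c..d}" for n
    unfolding r_def
    by (intro absolutely_integrable_max_1 set_integral_diff absf) (auto intro: absolutely_integrable_continuous_real)
  have r_int: "r n integrable_on {c..d}" for n
    using r_abs set_lebesgue_integral_eq_integral(1) by blast
  have "(\<lambda>n. integral {c..d} (r n)) \<longlonglongrightarrow> integral {c..d} (\<lambda>x. 0)"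
  proof (rule dominated_convergence(2)[where h = "\<lambda>x. \<bar>f x\<bar>"])
    show "(\<lambda>x. \<bar>f x\<bar>) integrable_on {c..d}"
      using absf set_lebesgue_integral_eq_integral(1) by blast
    show "(\<lambda>n. r n x) \<longlonglongrightarrow> 0" for x
    proof (rule tendsto_eventually)
      obtain N where "\<bar>f x\<bar> \<le> real N" using real_arch_simple by blast
      then show "\<forall>\<^sub>F n in sequentially. r n x = 0"
        by (intro eventually_sequentiallyI[of N]) (auto simp: r_def)
    qed
  qed (use r_int in \<open>auto simp: r_def\<close>)
  then have "\<forall>\<^sub>F n in sequentially. integral {c..d} (r n) < \<eta> / 2"
    using \<open>\<eta> > 0\<close> by (intro order_tendstoD(2)[of _ 0]) auto
  then obtain n where n: "integral {c..d} (r n) < \<eta> / 2"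
    by (auto simp: eventually_sequentially)
  define \<delta> where "\<delta> = \<eta> / (2 * (real n + 1))"
  show "\<exists>\<delta>>0. \<forall>(k::nat) a b.
            (\<forall>i<k. c \<le> a i \<and> a i \<le> b i \<and> b i \<le> d) \<and>
            disjoint_family_on (\<lambda>i. {a i<..<b i}) {..<k} \<and> (\<Sum>i<k. b i - a i) < \<delta> \<longrightarrow>
            (\<Sum>i<k. \<bar>integral {c..b i} f - integral {c..a i} f\<bar>) < \<eta>"
  proof (intro exI conjI allI impI)
    show "\<delta> > 0" using \<open>\<eta> > 0\<close> by (simp add: \<delta>_def)
    fix k :: nat and a b :: "nat \<Rightarrow> real"
    assume "(\<forall>i<k. c \<le> a i \<and> a i \<le> b i \<and> b i \<le> d) \<and>
            disjoint_family_on (\<lambda>i. {a i<..<b i}) {..<k} \<and> (\<Sum>i<k. b i - a i) < \<delta>"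
    then have ab: "\<And>i. i < k \<Longrightarrow> c \<le> a i \<and> a i \<le> b i \<and> b i \<le> d"
      and disj: "disjoint_family_on (\<lambda>i. {a i<..<b i}) {..<k}"
      and tot: "(\<Sum>i<k. b i - a i) < \<delta>" by auto
    have fint: "f integrable_on {c..d}" using f set_lebesgue_integral_eq_integral(1) by blast
    have rsub: "r n integrable_on {a i<..<b i}" if "i < k" for i
      using integrable_on_subinterval[OF r_int, of "a i" "b i" n] ab[OF that]
      by (simp add: integrable_on_Icc_iff_Ioo)
    have one: "\<bar>integral {c..b i} f - integral {c..a i} f\<bar>
                 \<le> real n * (b i - a i) + integral {a i<..<b i} (r n)" if "i < k" for i
    proof -
      have I: "f integrable_on {a i..b i}" "r n integrable_on {a i..b i}"
        "f integrable_on {c..b i}"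
        using ab[OF that] integrable_on_subinterval[OF fint] integrable_on_subinterval[OF r_int] by auto
      have "integral {c..b i} f = integral {c..a i} f + integral {a i..b i} f"
        using Henstock_Kurzweil_Integration.integral_combine[where a=c and c="a i" and b="b i" and f=f] ab[OF that] I by auto
      then have "\<bar>integral {c..b i} f - integral {c..a i} f\<bar> = \<bar>integral {a i..b i} f\<bar>" by simp
      also have "\<dots> \<le> integral {a i..b i} (\<lambda>x. real n + r n x)"
      proof -
        have "norm (integral {a i..b i} f) \<le> integral {a i..b i} (\<lambda>x. real n + r n x)"
          using I by (intro integral_norm_bound_integral integrable_add) (auto simp: r_bound)
        then show ?thesis by simp
      qed
      also have "\<dots> = real n * (b i - a i) + integral {a i..b i} (r n)"
        using ab[OF that] I by (subst integral_add) auto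
      finally show ?thesis by (simp add: integral_open_interval_real)
    qed
    have U: "(r n has_integral (\<Sum>i<k. integral {a i<..<b i} (r n))) (\<Union>i<k. {a i<..<b i})"
      using rsub disj
      by (intro has_integral_UN) (auto simp: disjoint_family_on_def pairwise_def integrable_integral)
    have "(\<Sum>i<k. integral {a i<..<b i} (r n)) = integral (\<Union>i<k. {a i<..<b i}) (r n)"
      using U by (simp add: integral_unique)
    also have "\<dots> \<le> integral {c..d} (r n)"
      using U r_int ab by (intro integral_subset_le) (force simp: r_def has_integral_integrable)+
    finally have R: "(\<Sum>i<k. integral {a i<..<b i} (r n)) < \<eta> / 2" using n by simp
    have "(\<Sum>i<k. \<bar>integral {c..b i} f - integral {c..a i} f\<bar>)
          \<le> (\<Sum>i<k. real n * (b i - a i) + integral {a i<..<b i} (r n))"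
      by (intro sum_mono one) auto
    also have "\<dots> = real n * (\<Sum>i<k. b i - a i) + (\<Sum>i<k. integral {a i<..<b i} (r n))"
      by (simp add: sum.distrib sum_distrib_left)
    also have "\<dots> < \<eta>"
    proof -
      have "real n * (\<Sum>i<k. b i - a i) \<le> real n * \<delta>" using tot by (intro mult_left_mono) auto
      also have "\<dots> \<le> \<eta> / 2" using \<open>\<eta> > 0\<close> by (simp add: \<delta>_def field_simps)
      finally show ?thesis using R by linarith
    qed
    finally show "(\<Sum>i<k. \<bar>integral {c..b i} f - integral {c..a i} f\<bar>) < \<eta>" .
  qed
qed

text \<open>Lebesgue's differentiation theorem on the line.  If the derivative of \<open>F\<close> at \<open>x\<close> is not
\<open>f x\<close>, then for some \<open>k\<close> there are arbitrarily short intervals with endpoint \<open>x\<close> on which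
\<open>f x\<close> times the length misses the integral of \<open>f\<close> by more than the fraction \<open>1 / (k + 1)\<close> of the
length.  These intervals form a Vitali cover of the set \<open>Bad k\<close> of such points.  For finitely many
disjoint ones, tagged by \<open>x\<close>, Henstock's lemma makes the sum of the errors, hence their total length,
as small as desired; so \<open>Bad k\<close> is null.\<close>

lemma indefinite_integral_has_derivative_ae:
  fixes f :: "real \<Rightarrow> real"
  assumes f: "f integrable_on {a..b}"
  shows "negligible {x \<in> {a..b}.
           \<not> ((\<lambda>y. integral {a..y} f) has_real_derivative f x) (at x within {a..b})}"
proof -
  define F where "F y = integral {a..y} f" for y
  define Bad where "Bad k = {x \<in> {a..b}. \<forall>d>0. \<exists>y\<in>{a..b}. y \<noteq> x \<and> \<bar>y - x\<bar> < d \<and>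
      \<bar>y - x\<bar> / real (Suc k) < \<bar>F y - F x - f x * (y - x)\<bar>}" for k
  have "negligible (Bad k)" for k
    unfolding negligible_outer_le
  proof (intro allI impI)
    fix e :: real assume "e > 0"
    have "e / real (Suc k) > 0" using \<open>e > 0\<close> by simp
    then obtain \<gamma> where "gauge \<gamma>" and \<gamma>: "\<And>p. \<lbrakk>p tagged_partial_division_of (cbox a b); \<gamma> fine p\<rbrakk> \<Longrightarrow>
       (\<Sum>(x,K)\<in>p. norm (measure lborel K *\<^sub>R f x - integral K f)) < e / real (Suc k)"
      using Henstock_lemma[of f a b "e / real (Suc k)"] f by auto
    \<comment> \<open>A pair stands for the segment between its components, with the first component as the
        tag; the tag may be either end.\<close>
    define I where "I = {(x, y). x \<in> {a..b} \<and> y \<in> {a..b} \<and> y \<noteq> x \<and> closed_segment x y \<subseteq> \<gamma> x \<and>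
      \<bar>y - x\<bar> / real (Suc k) < \<bar>F y - F x - f x * (y - x)\<bar>}"
    define cent where "cent = (\<lambda>(x::real, y). (x + y) / 2)"
    define rad where "rad = (\<lambda>(x::real, y). \<bar>y - x\<bar> / 2)"
    have cb: "cball (cent i) (rad i) = closed_segment (fst i) (snd i)" for i
      by (cases i) (auto simp: cent_def rad_def cball_eq_atLeastAtMost closed_segment_eq_real_ivl field_simps abs_if)
    have rad_pos: "0 < rad i" if "i \<in> I" for i using that by (auto simp: I_def rad_def)
    have vit: "\<exists>i. i \<in> I \<and> x \<in> cball (cent i) (rad i) \<and> rad i < d" if "x \<in> Bad k" "0 < d" for x d
    proof -
      obtain r where "r > 0" "ball x r \<subseteq> \<gamma> x"
        using \<open>gauge \<gamma>\<close> open_contains_ball unfolding gauge_def by blast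
      with that obtain y where y: "y \<in> {a..b}" "y \<noteq> x" "\<bar>y - x\<bar> < min d r"
          "\<bar>y - x\<bar> / real (Suc k) < \<bar>F y - F x - f x * (y - x)\<bar>"
        unfolding Bad_def mem_Collect_eq by (meson min_less_iff_conj)
      have "closed_segment x y \<subseteq> ball x r"
        using y(3) \<open>r > 0\<close> by (intro closed_segment_subset) (auto simp: dist_real_def)
      with \<open>ball x r \<subseteq> \<gamma> x\<close> y that(1) have "(x, y) \<in> I" by (auto simp: I_def Bad_def)
      moreover have "x \<in> cball (cent (x, y)) (rad (x, y))" by (simp add: cb)
      moreover have "rad (x, y) < d" using y \<open>d > 0\<close> by (auto simp: rad_def)
      ultimately show ?thesis by blast
    qed
    obtain C where C: "countable C" "C \<subseteq> I"
      and disj: "pairwise (\<lambda>i j. disjnt (cball (cent i) (rad i)) (cball (cent j) (rad j))) C"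
      and neg: "negligible (Bad k - (\<Union>i\<in>C. cball (cent i) (rad i)))"
      using Vitali_covering_theorem_cballs[of I rad "Bad k" cent, OF rad_pos vit] by blast
    have fin: "measure lebesgue (\<Union>i\<in>D. cball (cent i) (rad i)) \<le> e" if D: "D \<subseteq> C" "finite D" for D
    proof -
      let ?p = "(\<lambda>i. (fst i, cball (cent i) (rad i))) ` D"
      have inj: "inj_on (\<lambda>i. (fst i, cball (cent i) (rad i))) D"
      proof (rule inj_onI, rule ccontr)
        fix i j assume ij: "i \<in> D" "j \<in> D" "(fst i, cball (cent i) (rad i)) = (fst j, cball (cent j) (rad j))" "i \<noteq> j"
        then have "disjnt (cball (cent i) (rad i)) (cball (cent j) (rad j))"
          using disj D unfolding pairwise_def by blast
        moreover have "fst i \<in> cball (cent i) (rad i)" "fst j \<in> cball (cent j) (rad j)"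
          by (simp_all add: cb)
        moreover have "fst i = fst j" using ij(3) by simp
        ultimately show False unfolding disjnt_iff by metis
      qed
      have "?p tagged_partial_division_of (cbox a b)"
        unfolding tagged_partial_division_of_def
      proof (intro conjI allI impI)
        show "finite ?p" using D by simp
        fix x K assume "(x, K) \<in> ?p"
        then obtain i where i: "i \<in> D" "x = fst i" "K = cball (cent i) (rad i)" by auto
        then show "x \<in> K" by (simp add: cb)
        have "i \<in> I" using i D C by auto
        then show "K \<subseteq> cbox a b"
          unfolding i cb by (intro closed_segment_subset) (auto simp: I_def)
        show "\<exists>u v. K = cbox u v"
          unfolding i cball_eq_atLeastAtMost by auto
      next
        fix x1 K1 x2 K2 assume "(x1, K1) \<in> ?p \<and> (x2, K2) \<in> ?p \<and> (x1, K1) \<noteq> (x2, K2)"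
        then obtain i j where ij: "i \<in> D" "x1 = fst i" "K1 = cball (cent i) (rad i)"
            "j \<in> D" "x2 = fst j" "K2 = cball (cent j) (rad j)" "(x1, K1) \<noteq> (x2, K2)"
          unfolding image_iff by blast
        then have "i \<noteq> j" by blast
        then have "disjnt K1 K2" using pairwiseD[OF disj, of i j] ij D by blast
        then have "K1 \<inter> K2 = {}" by (simp add: disjnt_def)
        then show "interior K1 \<inter> interior K2 = {}" using interior_subset by blast
      qed
      moreover have "\<gamma> fine ?p"
      proof (rule fineI)
        fix x K assume "(x, K) \<in> ?p"
        then obtain i where i: "i \<in> D" "x = fst i" "K = cball (cent i) (rad i)" by auto
        then have "i \<in> I" using D C by blast
        then show "K \<subseteq> \<gamma> x" unfolding i cb by (auto simp: I_def)
      qed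
      ultimately have "(\<Sum>(x,K)\<in>?p. norm (measure lborel K *\<^sub>R f x - integral K f)) < e / real (Suc k)"
        by (rule \<gamma>)
      then have small: "(\<Sum>i\<in>D. \<bar>measure lborel (cball (cent i) (rad i)) * f (fst i) -
            integral (cball (cent i) (rad i)) f\<bar>) < e / real (Suc k)"
        by (subst (asm) sum.reindex[OF inj]) (simp add: o_def)
      have each: "measure lebesgue (cball (cent i) (rad i)) / real (Suc k) \<le>
          \<bar>measure lborel (cball (cent i) (rad i)) * f (fst i) - integral (cball (cent i) (rad i)) f\<bar>"
        if iD: "i \<in> D" for i
      proof -
        obtain x y where i: "i = (x, y)" by (cases i)
        have xy: "x \<in> {a..b}" "y \<in> {a..b}" "y \<noteq> x" "\<bar>y - x\<bar> / real (Suc k) < \<bar>F y - F x - f x * (y - x)\<bar>"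
          using iD D C unfolding I_def i by auto
        have int: "f integrable_on {a..t}" if "t \<in> {a..b}" for t
          using integrable_on_subinterval[OF f] that by auto
        show ?thesis
        proof (cases "x < y")
          case True
          then have "F y = F x + integral {x..y} f"
            unfolding F_def using Henstock_Kurzweil_Integration.integral_combine[where a=a and c=x and b=y and f=f]
              int[OF xy(2)] xy by auto
          then show ?thesis using xy True
            by (simp add: i cb closed_segment_eq_real_ivl algebra_simps abs_if split: if_splits)
        next
          case False
          then have "F x = F y + integral {y..x} f"
            unfolding F_def using Henstock_Kurzweil_Integration.integral_combine[where a=a and c=y and b=x and f=f]
              int[OF xy(1)] xy by auto
          then show ?thesis using xy False
            by (simp add: i cb closed_segment_eq_real_ivl algebra_simps abs_if split: if_splits)
        qed
      qed
      have "measure lebesgue (\<Union>i\<in>D. cball (cent i) (rad i))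
              \<le> (\<Sum>i\<in>D. measure lebesgue (cball (cent i) (rad i)))"
        using D by (intro measure_UNION_le) auto
      also have "\<dots> = real (Suc k) * (\<Sum>i\<in>D. measure lebesgue (cball (cent i) (rad i)) / real (Suc k))"
        by (simp add: sum_distrib_left)
      also have "\<dots> \<le> real (Suc k) * (e / real (Suc k))"
        using order_trans[OF sum_mono[OF each] less_imp_le[OF small]] by (intro mult_left_mono) auto
      finally show ?thesis by simp
    qed
    have meas: "(\<Union>i\<in>C. cball (cent i) (rad i)) \<in> lmeasurable \<and>
                measure lebesgue (\<Union>i\<in>C. cball (cent i) (rad i)) \<le> e"
      using fmeasurable_UN_bound[OF C(1) lmeasurable_cball fin] measure_UN_bound[OF C(1) lmeasurable_cball fin]
      by (rule conjI)
    show "\<exists>T. Bad k \<subseteq> T \<and> T \<in> lmeasurable \<and> measure lebesgue T \<le> e"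
    proof (intro exI conjI)
      let ?U = "\<Union>i\<in>C. cball (cent i) (rad i)"
      show "Bad k \<subseteq> ?U \<union> (Bad k - ?U)" by blast
      show "?U \<union> (Bad k - ?U) \<in> lmeasurable"
        using meas neg negligible_imp_measurable by blast
      have "measure lebesgue (?U \<union> (Bad k - ?U)) \<le> measure lebesgue ?U + measure lebesgue (Bad k - ?U)"
        using meas neg by (intro measure_Un_le) (auto dest: negligible_imp_sets fmeasurableD)
      then show "measure lebesgue (?U \<union> (Bad k - ?U)) \<le> e"
        using meas negligible_imp_measure0[OF neg] by linarith
    qed
  qed
  then have "negligible (\<Union>k. Bad k)" by (intro negligible_countable_Union) auto
  moreover have "{x \<in> {a..b}. \<not> (F has_real_derivative f x) (at x within {a..b})} \<subseteq> (\<Union>k. Bad k)"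
  proof (rule subsetI, rule ccontr)
    fix x assume x: "x \<in> {x \<in> {a..b}. \<not> (F has_real_derivative f x) (at x within {a..b})}"
      and nb: "x \<notin> (\<Union>k. Bad k)"
    have "(F has_derivative (\<lambda>h. f x * h)) (at x within {a..b})"
      unfolding has_derivative_within_alt
    proof (intro conjI allI impI)
      show "bounded_linear ((*) (f x))" by (rule bounded_linear_mult_right)
      fix e :: real assume "e > 0"
      obtain k where k: "inverse (real (Suc k)) < e" using reals_Archimedean[OF \<open>e > 0\<close>] by auto
      have "x \<notin> Bad k" using nb by blast
      with x obtain d where "d > 0" and d: "\<And>y. \<lbrakk>y \<in> {a..b}; y \<noteq> x; \<bar>y - x\<bar> < d\<rbrakk> \<Longrightarrow>
          \<bar>F y - F x - f x * (y - x)\<bar> \<le> \<bar>y - x\<bar> / real (Suc k)"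
        unfolding Bad_def mem_Collect_eq by (meson not_less)
      show "\<exists>d>0. \<forall>y\<in>{a..b}. norm (y - x) < d \<longrightarrow> norm (F y - F x - f x * (y - x)) \<le> e * norm (y - x)"
      proof (intro exI[of _ d] conjI ballI impI \<open>d > 0\<close>)
        fix y assume y: "y \<in> {a..b}" "norm (y - x) < d"
        show "norm (F y - F x - f x * (y - x)) \<le> e * norm (y - x)"
        proof (cases "y = x")
          case False
          then have "\<bar>F y - F x - f x * (y - x)\<bar> \<le> inverse (real (Suc k)) * \<bar>y - x\<bar>"
            using d[of y] y by (simp add: field_simps)
          also have "\<dots> \<le> e * \<bar>y - x\<bar>" using k by (intro mult_right_mono) auto
          finally show ?thesis by simp
        qed simp
      qed
    qed
    with x show False by (simp add: has_field_derivative_def)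
  qed
  ultimately show ?thesis unfolding F_def by (rule negligible_subset)
qed

section \<open>Periodic orbits of bounded planar fields\<close>

lemma continuous_delayed_field:
  fixes F :: "real \<Rightarrow> 'a::real_normed_vector \<Rightarrow> 'b::real_normed_vector"
  assumes cont: "continuous_on UNIV (\<lambda>(t, x). F t x)"
    and lip: "\<And>s t. norm (Z t - Z s) \<le> C * \<bar>t - s\<bar>"
  shows "continuous_on S (\<lambda>s. F s (Z (s - h)))"
proof -
  have "C \<ge> 0" using order_trans[OF norm_ge_zero lip[of 1 0]] by simp
  then have "continuous_on UNIV Z"
    using lip by (intro lipschitz_on_continuous_on[of C] lipschitz_onI) (auto simp: dist_norm)
  then have "continuous_on S (\<lambda>s. Z (s - h))"
    by (rule continuous_on_compose2) (auto intro!: continuous_intros)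
  then have "continuous_on S (\<lambda>s. (s, Z (s - h)))"
    by (intro continuous_intros)
  from continuous_on_compose2[OF cont this] show ?thesis by simp
qed

text \<open>The equation \<open>X'(t) = F(t, X(t - h))\<close> is solved by integration on one interval of length \<open>h\<close>
after another.  The solution is therefore unique and continuous in its initial value, whereas for the
undelayed equation both may fail, as \<open>F\<close> is only continuous.  The steps are realised by iterating the
integral operator \<open>S\<close>, starting from the constant functions: after \<open>n\<close> iterations the result is
final on \<open>(-\<infinity>, n h]\<close>.\<close>

lemma delay_approximation:
  fixes F :: "real \<Rightarrow> 'a::euclidean_space \<Rightarrow> 'a"
  assumes cont: "continuous_on UNIV (\<lambda>(t, x). F t x)" and bd: "\<And>t x. norm (F t x) \<le> C" and "h > 0"
  obtains X where "\<And>x t. t \<le> 0 \<Longrightarrow> X x t = x"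
    and "\<And>x t. \<lbrakk>0 \<le> t; t \<le> T\<rbrakk> \<Longrightarrow> X x t = x + integral {0..t} (\<lambda>s. F s (X x (s - h)))"
    and "\<And>x s t. norm (X x t - X x s) \<le> C * \<bar>t - s\<bar>"
    and "\<And>t. continuous_on UNIV (\<lambda>x. X x t)"
proof -
  \<comment> \<open>The upper limit max 0 t extends the solution to negative times by its initial value.\<close>
  define S where "S Z x t = x + integral {0..max 0 t} (\<lambda>s. F s (Z x (s - h)))"
    for Z :: "'a \<Rightarrow> real \<Rightarrow> 'a" and x t
  define Y where "Y n = (S ^^ n) (\<lambda>x t. x)" for n
  have Y_Suc: "Y (Suc n) = S (Y n)" for n by (simp add: Y_def)
  have "C \<ge> 0" using bd norm_ge_zero order_trans by blast
  have int: "(\<lambda>s. F s (Z (s - h))) integrable_on {a..b}"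
    if "\<And>s t. norm (Z t - Z s) \<le> C * \<bar>t - s\<bar>" for Z a b
    by (intro integrable_continuous_interval continuous_delayed_field[OF cont that])
  have lip: "norm (Y n x t - Y n x s) \<le> C * \<bar>t - s\<bar>" for n x s t
  proof (induction n arbitrary: s t)
    case 0
    then show ?case using \<open>C \<ge> 0\<close> by (simp add: Y_def)
  next
    case (Suc n)
    have le: "norm (Y (Suc n) x t - Y (Suc n) x s) \<le> C * (t - s)" if "s \<le> t" for s t
    proof -
      let ?a = "max 0 s" and ?b = "max 0 t" and ?f = "\<lambda>s. F s (Y n x (s - h))"
      have f: "?f integrable_on {a..b}" for a b by (rule int[OF Suc.IH])
      have "integral {0..?a} ?f + integral {?a..?b} ?f = integral {0..?b} ?f"
        using that by (intro Henstock_Kurzweil_Integration.integral_combine f) auto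
      then have "integral {0..?b} ?f - integral {0..?a} ?f = integral {?a..?b} ?f"
        by (metis add_diff_cancel_left')
      moreover have "Y (Suc n) x t - Y (Suc n) x s = integral {0..?b} ?f - integral {0..?a} ?f"
        by (simp only: Y_Suc S_def add_diff_cancel_left)
      ultimately have "norm (Y (Suc n) x t - Y (Suc n) x s) = norm (integral {?a..?b} ?f)"
        by (simp only:)
      also have "\<dots> \<le> integral {?a..?b} (\<lambda>s. C)"
        by (intro integral_norm_bound_integral f bd) auto
      also have "\<dots> = C * (?b - ?a)" using that by simp
      also have "\<dots> \<le> C * (t - s)" using that \<open>C \<ge> 0\<close> by (intro mult_left_mono) auto
      finally show ?thesis .
    qed
    show ?case
      using le[of s t] le[of t s] by (cases "s \<le> t") (auto simp: norm_minus_commute)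
  qed
  have contx: "continuous_on UNIV (\<lambda>x. Y n x t)" for n t
  proof (induction n arbitrary: t)
    case 0
    then show ?case by (simp add: Y_def)
  next
    case (Suc n)
    have "continuous_on UNIV (\<lambda>x. integral {0..max 0 t} (\<lambda>s. F s (Y n x (s - h))))"
    proof (rule continuous_on_sequentiallyI)
      fix u :: "nat \<Rightarrow> 'a" and a assume u: "u \<longlonglongrightarrow> a"
      show "(\<lambda>m. integral {0..max 0 t} (\<lambda>s. F s (Y n (u m) (s - h))))
              \<longlonglongrightarrow> integral {0..max 0 t} (\<lambda>s. F s (Y n a (s - h)))"
      proof (rule dominated_convergence(2)[where h = "\<lambda>s. C"])
        fix s
        have "(\<lambda>m. (s, Y n (u m) (s - h))) \<longlonglongrightarrow> (s, Y n a (s - h))"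
          using continuous_on_tendsto_compose[OF Suc.IH u] by (intro tendsto_intros) auto
        from continuous_on_tendsto_compose[OF cont this]
        show "(\<lambda>m. F s (Y n (u m) (s - h))) \<longlonglongrightarrow> F s (Y n a (s - h))" by simp
      qed (auto intro: int lip bd)
    qed
    then show ?case by (auto simp: Y_Suc S_def intro!: continuous_intros)
  qed
  have stable: "Y (Suc n) x t = Y n x t" if "t \<le> real n * h" for n x t
    using that
  proof (induction n arbitrary: t)
    case 0
    then show ?case by (simp add: Y_def S_def max_absorb1)
  next
    case (Suc n)
    have "integral {0..max 0 t} (\<lambda>s. F s (Y (Suc n) x (s - h))) = integral {0..max 0 t} (\<lambda>s. F s (Y n x (s - h)))"
    proof (rule Henstock_Kurzweil_Integration.integral_cong)
      fix s assume "s \<in> {0..max 0 t}"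
      then have "s - h \<le> real n * h" using Suc.prems \<open>h > 0\<close>
        by (auto simp: algebra_simps max_def split: if_splits intro: order_trans)
      then show "F s (Y (Suc n) x (s - h)) = F s (Y n x (s - h))" by (simp add: Suc.IH)
    qed
    then show ?case by (simp add: Y_Suc[of "Suc n"] Y_Suc[of n] S_def)
  qed
  obtain N where "T / h \<le> real N" using real_arch_simple by blast
  then have N: "T \<le> real N * h" using \<open>h > 0\<close> by (simp add: field_simps)
  show thesis
  proof (rule that[of "Y N"])
    show "Y N x t = x" if "t \<le> 0" for x t
      using that by (cases N) (auto simp: Y_def S_def max_absorb1)
    show "Y N x t = x + integral {0..t} (\<lambda>s. F s (Y N x (s - h)))" if "0 \<le> t" "t \<le> T" for x t
      using stable[of t N x] N that by (simp add: Y_Suc S_def max_absorb2)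
  qed (rule lip contx)+
qed

text \<open>The nearest point to \<open>z\<close> in \<open>[-c, c]\<close>, for \<open>c \<ge> 0\<close>.\<close>

definition trunc :: "real \<Rightarrow> real \<Rightarrow> real" where
  "trunc c z = max (- c) (min c z)"

lemma abs_trunc_le: "0 \<le> c \<Longrightarrow> \<bar>trunc c z\<bar> \<le> c"
  by (auto simp: trunc_def)

lemma trunc_id: "\<bar>z\<bar> \<le> c \<Longrightarrow> trunc c z = z"
  by (auto simp: trunc_def)

lemma continuous_on_trunc [continuous_intros]:
  "continuous_on S f \<Longrightarrow> continuous_on S (\<lambda>x. trunc c (f x))"
  unfolding trunc_def by (intro continuous_intros)

text \<open>Brouwer's theorem is applied to \<open>(w, u) \<mapsto> (w - d2, u - d1)\<close>, projected back to the square.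
If a coordinate of the fixed point was moved by the projection, then the point lies on the side
towards which it was pushed, and the sign of the displacement on that side says that it was pushed the other
way.  The components are paired crosswise: \<open>d1\<close> changes sign with the second coordinate and \<open>d2\<close>
with the first, as for the displacement of the system \<open>w' = u\<close>, \<open>u' = w\<close>.\<close>

lemma poincare_miranda_square:
  fixes d1 d2 :: "real \<times> real \<Rightarrow> real"
  assumes "A \<ge> 0" and d1: "continuous_on (cbox (-A, -A) (A, A)) d1"
    and d2: "continuous_on (cbox (-A, -A) (A, A)) d2"
    and s1: "\<And>w. \<bar>w\<bar> \<le> A \<Longrightarrow> d1 (w, -A) \<le> 0" "\<And>w. \<bar>w\<bar> \<le> A \<Longrightarrow> d1 (w, A) \<ge> 0"
    and s2: "\<And>u. \<bar>u\<bar> \<le> A \<Longrightarrow> d2 (-A, u) \<le> 0" "\<And>u. \<bar>u\<bar> \<le> A \<Longrightarrow> d2 (A, u) \<ge> 0"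
  obtains x where "x \<in> cbox (-A, -A) (A, A)" "d1 x = 0" "d2 x = 0"
proof -
  let ?R = "cbox (-A, -A) (A, A)"
  note cl = abs_trunc_le[OF \<open>A \<ge> 0\<close>]
  have R: "(w, u) \<in> ?R \<longleftrightarrow> \<bar>w\<bar> \<le> A \<and> \<bar>u\<bar> \<le> A" for w u by (auto simp: cbox_Pair_iff)
  obtain x where x: "x \<in> ?R" "(trunc A (fst x - d2 x), trunc A (snd x - d1 x)) = x"
  proof (rule brouwer[of ?R "\<lambda>x. (trunc A (fst x - d2 x), trunc A (snd x - d1 x))"])
    have "(0, 0) \<in> ?R" using R \<open>A \<ge> 0\<close> by simp
    then show "?R \<noteq> {}" by blast
    show "continuous_on ?R (\<lambda>x. (trunc A (fst x - d2 x), trunc A (snd x - d1 x)))"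
      by (intro continuous_intros d1 d2)
    show "(\<lambda>x. (trunc A (fst x - d2 x), trunc A (snd x - d1 x))) \<in> ?R \<rightarrow> ?R"
      using cl R by auto
  qed auto
  obtain w u where wu: "x = (w, u)" by (cases x)
  have e: "trunc A (w - d2 x) = w" "trunc A (u - d1 x) = u" "\<bar>w\<bar> \<le> A" "\<bar>u\<bar> \<le> A"
    using x R by (auto simp: wu)
  have "d2 x = 0"
  proof (rule linorder_cases[of "d2 x" 0])
    assume "d2 x < 0"
    then have "w = A" using e by (auto simp: trunc_def max_def min_def split: if_splits)
    with s2(2)[of u] e wu \<open>d2 x < 0\<close> show ?thesis by auto
  next
    assume "d2 x > 0"
    then have "w = -A" using e by (auto simp: trunc_def max_def min_def split: if_splits)
    with s2(1)[of u] e wu \<open>d2 x > 0\<close> show ?thesis by auto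
  qed
  moreover have "d1 x = 0"
  proof (rule linorder_cases[of "d1 x" 0])
    assume "d1 x < 0"
    then have "u = A" using e by (auto simp: trunc_def max_def min_def split: if_splits)
    with s1(2)[of w] e wu \<open>d1 x < 0\<close> show ?thesis by auto
  next
    assume "d1 x > 0"
    then have "u = -A" using e by (auto simp: trunc_def max_def min_def split: if_splits)
    with s1(1)[of w] e wu \<open>d1 x > 0\<close> show ?thesis by auto
  qed
  ultimately show thesis using that x by blast
qed

text \<open>For the equation with delay \<open>h\<close>, an orbit moves by at most \<open>C T\<close> during a period.  If it starts on a
side of the square of half-width \<open>A = |K| + C T\<close>, it stays where the hypotheses fix the sign of the
relevant component of \<open>F\<close>, so the sign of the displacement over the period is known on all four sides
and vanishes somewhere in the square.  The periodic orbits found in this way are bounded and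
equi-Lipschitz uniformly in the delay; a uniform limit as \<open>h\<close> tends to 0 solves the equation without
delay.\<close>

theorem planar_periodic_solution:
  fixes F :: "real \<Rightarrow> real \<times> real \<Rightarrow> real \<times> real"
  assumes "T > 0" and cont: "continuous_on UNIV (\<lambda>(t, x). F t x)" and bd: "\<And>t x. norm (F t x) \<le> C"
    and s1: "\<And>t w u. u \<le> -K \<Longrightarrow> fst (F t (w, u)) \<le> 0" "\<And>t w u. K \<le> u \<Longrightarrow> fst (F t (w, u)) \<ge> 0"
    and s2: "\<And>t w u. w \<le> -K \<Longrightarrow> snd (F t (w, u)) \<le> 0" "\<And>t w u. K \<le> w \<Longrightarrow> snd (F t (w, u)) \<ge> 0"
  obtains X where "continuous_on {0..T} X" "X T = X 0"
    "\<And>t. t \<in> {0..T} \<Longrightarrow> X t = X 0 + integral {0..t} (\<lambda>s. F s (X s))"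
proof -
  have "C \<ge> 0" using bd norm_ge_zero order_trans by blast
  define A where "A = \<bar>K\<bar> + C * T"
  have "A \<ge> 0" using \<open>C \<ge> 0\<close> \<open>T > 0\<close> by (simp add: A_def)
  define h where "h n = 1 / real (Suc n)" for n
  have h: "h n > 0" for n by (simp add: h_def)
  have ex: "\<exists>Z. Z T = Z 0 \<and> norm (Z 0) \<le> 2 * A \<and> (\<forall>s t. norm (Z t - Z s) \<le> C * \<bar>t - s\<bar>) \<and>
      (\<forall>t\<in>{0..T}. Z t = Z 0 + integral {0..t} (\<lambda>s. F s (Z (s - h n))))" for n
  proof -
    obtain X where X0: "\<And>x t. t \<le> 0 \<Longrightarrow> X x t = x"
      and X: "\<And>x t. \<lbrakk>0 \<le> t; t \<le> T\<rbrakk> \<Longrightarrow> X x t = x + integral {0..t} (\<lambda>s. F s (X x (s - h n)))"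
      and lip: "\<And>x s t. norm (X x t - X x s) \<le> C * \<bar>t - s\<bar>"
      and cX: "\<And>t. continuous_on UNIV (\<lambda>x. X x t)"
      by (rule delay_approximation[OF cont bd h[of n], of T]) (rule that)
    let ?d = "\<lambda>x. X x T - x"
    have cd: "continuous_on UNIV ?d" by (intro continuous_intros cX)
    have near: "norm (X x (s - h n) - x) \<le> C * T" if "s \<le> T" for x s
    proof (cases "s - h n \<le> 0")
      case True
      then show ?thesis using \<open>C \<ge> 0\<close> \<open>T > 0\<close> by (simp add: X0)
    next
      case False
      have "norm (X x (s - h n) - X x 0) \<le> C * \<bar>s - h n\<bar>" using lip[of x "s - h n" 0] by simp
      also have "\<dots> \<le> C * T" using False that h[of n] \<open>C \<ge> 0\<close> by (intro mult_left_mono) auto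
      finally show ?thesis by (simp add: X0)
    qed
    have near1: "\<bar>fst (X x (s - h n)) - fst x\<bar> \<le> C * T" "\<bar>snd (X x (s - h n)) - snd x\<bar> \<le> C * T"
      if "s \<le> T" for x s
    proof -
      have "\<bar>fst z\<bar> \<le> norm z" "\<bar>snd z\<bar> \<le> norm z" for z :: "real \<times> real"
        using norm_fst_le[of "fst z" "snd z"] norm_snd_le[of "snd z" "fst z"] by simp_all
      from this[of "X x (s - h n) - x"] near[OF that, of x]
      show "\<bar>fst (X x (s - h n)) - fst x\<bar> \<le> C * T" "\<bar>snd (X x (s - h n)) - snd x\<bar> \<le> C * T"
        by (simp_all add: fst_diff snd_diff)
    qed
    have cF: "continuous_on {0..T} (\<lambda>s. F s (X x (s - h n)))" for x
      by (rule continuous_delayed_field[OF cont lip])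
    have iF: "(\<lambda>s. F s (X x (s - h n))) integrable_on {0..T}" for x
      by (rule integrable_continuous_interval[OF cF])
    have d: "fst (?d x) = integral {0..T} (\<lambda>s. fst (F s (X x (s - h n))))"
            "snd (?d x) = integral {0..T} (\<lambda>s. snd (F s (X x (s - h n))))" for x
      using X[of T x] \<open>T > 0\<close> integral_linear[OF iF bounded_linear_fst, of x] integral_linear[OF iF bounded_linear_snd, of x]
      by (simp_all add: o_def)
    have i1: "(\<lambda>s. fst (F s (X x (s - h n)))) integrable_on {0..T}"
             "(\<lambda>s. snd (F s (X x (s - h n)))) integrable_on {0..T}" for x
      using integrable_linear[OF iF bounded_linear_fst, of x] integrable_linear[OF iF bounded_linear_snd, of x]
      by (simp_all add: o_def)
    have nonpos: "integral {0..T} f \<le> 0"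
      if "f integrable_on {0..T}" "\<And>s. s \<in> {0..T} \<Longrightarrow> f s \<le> 0" for f :: "real \<Rightarrow> real"
      using integral_le[OF that(1) integrable_0] that(2) by simp
    obtain x where x: "x \<in> cbox (-A, -A) (A, A)" "fst (?d x) = 0" "snd (?d x) = 0"
    proof (rule poincare_miranda_square[OF \<open>A \<ge> 0\<close>, of "\<lambda>x. fst (?d x)" "\<lambda>x. snd (?d x)"])
      show "continuous_on (cbox (-A, -A) (A, A)) (\<lambda>x. fst (?d x))"
        "continuous_on (cbox (-A, -A) (A, A)) (\<lambda>x. snd (?d x))"
        by (rule continuous_on_subset[OF _ subset_UNIV], intro continuous_on_fst continuous_on_snd cd)+
      show "fst (?d (w, -A)) \<le> 0" for w
        unfolding d
      proof (rule nonpos[OF i1(1)])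
        fix s assume "s \<in> {0..T}"
        then have "snd (X (w, -A) (s - h n)) \<le> -K" using near1(2)[of s "(w, -A)"] by (auto simp: A_def)
        then show "fst (F s (X (w, -A) (s - h n))) \<le> 0" using s1(1) by (metis prod.collapse)
      qed
      show "0 \<le> fst (?d (w, A))" for w
        unfolding d
      proof (rule Henstock_Kurzweil_Integration.integral_nonneg[OF i1(1)])
        fix s assume "s \<in> {0..T}"
        then have "snd (X (w, A) (s - h n)) \<ge> K" using near1(2)[of s "(w, A)"] by (auto simp: A_def)
        then show "fst (F s (X (w, A) (s - h n))) \<ge> 0" using s1(2) by (metis prod.collapse)
      qed
      show "snd (?d (-A, u)) \<le> 0" for u
        unfolding d
      proof (rule nonpos[OF i1(2)])
        fix s assume "s \<in> {0..T}"
        then have "fst (X (-A, u) (s - h n)) \<le> -K" using near1(1)[of s "(-A, u)"] by (auto simp: A_def)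
        then show "snd (F s (X (-A, u) (s - h n))) \<le> 0" using s2(1) by (metis prod.collapse)
      qed
      show "0 \<le> snd (?d (A, u))" for u
        unfolding d
      proof (rule Henstock_Kurzweil_Integration.integral_nonneg[OF i1(2)])
        fix s assume "s \<in> {0..T}"
        then have "fst (X (A, u) (s - h n)) \<ge> K" using near1(1)[of s "(A, u)"] by (auto simp: A_def)
        then show "snd (F s (X (A, u) (s - h n))) \<ge> 0" using s2(2) by (metis prod.collapse)
      qed
    qed
    show ?thesis
    proof (intro exI conjI allI ballI)
      show "X x T = X x 0" using x(2,3) by (simp add: X0 prod_eq_iff)
      have "\<bar>fst x\<bar> \<le> A" "\<bar>snd x\<bar> \<le> A" using x(1) by (cases x; auto simp: cbox_Pair_iff)+
      then show "norm (X x 0) \<le> 2 * A"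
        using norm_Pair_le[of "fst x" "snd x"] by (simp add: X0)
      show "X x t = X x 0 + integral {0..t} (\<lambda>s. F s (X x (s - h n)))" if "t \<in> {0..T}" for t
        using X[of t x] that by (simp add: X0)
    qed (rule lip)
  qed
  obtain Z where "\<forall>n. Z n T = Z n 0 \<and> norm (Z n 0) \<le> 2 * A \<and>
      (\<forall>s t. norm (Z n t - Z n s) \<le> C * \<bar>t - s\<bar>) \<and>
      (\<forall>t\<in>{0..T}. Z n t = Z n 0 + integral {0..t} (\<lambda>s. F s (Z n (s - h n))))"
    using choice[OF allI[OF ex]] by (rule exE)
  then have per: "\<And>n. Z n T = Z n 0" and Z0: "\<And>n. norm (Z n 0) \<le> 2 * A"
    and lip: "\<And>n s t. norm (Z n t - Z n s) \<le> C * \<bar>t - s\<bar>"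
    and Z: "\<And>n t. t \<in> {0..T} \<Longrightarrow> Z n t = Z n 0 + integral {0..t} (\<lambda>s. F s (Z n (s - h n)))"
    by blast+
  obtain g k where g: "continuous_on {0..T} g" and k: "strict_mono (k :: nat \<Rightarrow> nat)"
    and unif: "\<And>e. 0 < e \<Longrightarrow> \<exists>N. \<forall>n x. n \<ge> N \<and> x \<in> {0..T} \<longrightarrow> norm (Z (k n) x - g x) < e"
  proof (rule Arzela_Ascoli[of "{0..T}" Z "2 * A + C * T"])
    show "norm (Z n t) \<le> 2 * A + C * T" if "t \<in> {0..T}" for n t
    proof -
      have "norm (Z n t - Z n 0) \<le> C * \<bar>t - 0\<bar>" by (rule lip)
      also have "\<dots> \<le> C * T" using that \<open>C \<ge> 0\<close> by (intro mult_left_mono) auto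
      finally have "norm (Z n t - Z n 0) \<le> C * T" .
      then show ?thesis using Z0[of n] norm_triangle_sub[of "Z n t" "Z n 0"] by linarith
    qed
    show "\<exists>d>0. \<forall>n y. y \<in> {0..T} \<and> norm (x - y) < d \<longrightarrow> norm (Z n x - Z n y) < e"
      if "e > 0" for x :: real and e
    proof (intro exI[of _ "e / (C + 1)"] conjI allI impI)
      show "e / (C + 1) > 0" using \<open>C \<ge> 0\<close> that by simp
      fix n y assume "y \<in> {0..T} \<and> norm (x - y) < e / (C + 1)"
      then have y: "\<bar>x - y\<bar> * (C + 1) < e" using \<open>C \<ge> 0\<close> by (simp add: field_simps)
      have "norm (Z n x - Z n y) \<le> C * \<bar>x - y\<bar>" by (rule lip)
      also have "\<dots> \<le> \<bar>x - y\<bar> * (C + 1)" by (simp add: algebra_simps)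
      finally show "norm (Z n x - Z n y) < e" using y by simp
    qed
  qed auto
  have lim: "(\<lambda>n. Z (k n) t) \<longlonglongrightarrow> g t" if "t \<in> {0..T}" for t
    using unif that by (intro LIMSEQ_I) blast
  have hk: "(\<lambda>n. h (k n)) \<longlonglongrightarrow> 0"
    using LIMSEQ_subseq_LIMSEQ[OF LIMSEQ_inverse_real_of_nat k]
    by (simp add: h_def o_def inverse_eq_divide)
  have lim': "(\<lambda>n. Z (k n) (t - h (k n))) \<longlonglongrightarrow> g t" if "t \<in> {0..T}" for t
  proof -
    have "(\<lambda>n. Z (k n) (t - h (k n)) - Z (k n) t) \<longlonglongrightarrow> 0"
    proof (rule Lim_null_comparison)
      show "\<forall>\<^sub>F n in sequentially. norm (Z (k n) (t - h (k n)) - Z (k n) t) \<le> C * \<bar>h (k n)\<bar>"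
        using lip by (metis (no_types, lifting) abs_minus_commute add_diff_cancel_left' diff_add_cancel always_eventually)
      show "(\<lambda>n. C * \<bar>h (k n)\<bar>) \<longlonglongrightarrow> 0"
        using tendsto_mult_left[OF tendsto_rabs[OF hk], of C] by simp
    qed
    from tendsto_add[OF this lim[OF that]] show ?thesis by simp
  qed
  show thesis
  proof (rule that[OF g])
    have "(\<lambda>n. Z (k n) T) \<longlonglongrightarrow> g 0" using lim[of 0] \<open>T > 0\<close> per by simp
    then show "g T = g 0" using lim[of T] \<open>T > 0\<close> LIMSEQ_unique by fastforce
    fix t assume t: "t \<in> {0..T}"
    have "(\<lambda>n. integral {0..t} (\<lambda>s. F s (Z (k n) (s - h (k n))))) \<longlonglongrightarrow> integral {0..t} (\<lambda>s. F s (g s))"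
    proof (rule dominated_convergence(2)[where h = "\<lambda>s. C"])
      show "(\<lambda>s. F s (Z (k n) (s - h (k n)))) integrable_on {0..t}" for n
        by (intro integrable_continuous_interval continuous_delayed_field[OF cont lip])
      fix s assume "s \<in> {0..t}"
      then have "(\<lambda>n. (s, Z (k n) (s - h (k n)))) \<longlonglongrightarrow> (s, g s)"
        using lim'[of s] t by (intro tendsto_intros) auto
      from continuous_on_tendsto_compose[OF cont this]
      show "(\<lambda>n. F s (Z (k n) (s - h (k n)))) \<longlonglongrightarrow> F s (g s)" by simp
    qed (auto intro: bd)
    moreover have "(\<lambda>n. Z (k n) 0) \<longlonglongrightarrow> g 0" using lim[of 0] \<open>T > 0\<close> by simp
    ultimately have "(\<lambda>n. Z (k n) t) \<longlonglongrightarrow> g 0 + integral {0..t} (\<lambda>s. F s (g s))"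
      using Z[OF t] by (auto dest: tendsto_add)
    with lim[OF t] show "g t = g 0 + integral {0..t} (\<lambda>s. F s (g s))"
      using LIMSEQ_unique by blast
  qed
qed

section \<open>The maps phi and their inverses\<close>

lemma phi_eq_sgn_powr: "phi q x = sgn x * \<bar>x\<bar> powr (q - 1)"
proof (cases "x = 0")
  case False
  have "\<bar>x\<bar> powr (q - 2 + 1) = \<bar>x\<bar> powr (q - 2) * \<bar>x\<bar>"
    using False by (subst powr_add) simp
  then show ?thesis using False by (simp add: phi_def sgn_if)
qed (simp add: phi_def)

lemma abs_phi: "\<bar>phi q x\<bar> = \<bar>x\<bar> powr (q - 1)"
  by (cases "x = 0") (auto simp: phi_eq_sgn_powr abs_mult)

lemma phi_0 [simp]: "phi q 0 = 0"
  by (simp add: phi_def)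

lemma phi_nonneg: "0 \<le> x \<Longrightarrow> 0 \<le> phi q x"
  and phi_nonpos: "x \<le> 0 \<Longrightarrow> phi q x \<le> 0"
  by (simp_all add: phi_def mult_nonneg_nonpos)

text \<open>For \<open>q, r > 1\<close> the hypothesis says that they are conjugate exponents, \<open>1/q + 1/r = 1\<close>.
The inverse of \<open>phi q\<close> is of the same form, so one continuity lemma serves for both.\<close>

lemma phi_conjugate_inverse:
  assumes "(q - 1) * (r - 1) = 1"
  shows "phi q (phi r x) = x"
proof (cases "x = 0")
  case False
  have "\<bar>phi r x\<bar> powr (q - 1) = \<bar>x\<bar>"
    using False assms by (simp add: abs_phi powr_powr mult.commute)
  moreover have "sgn (phi r x) = sgn x"
    using False by (simp add: phi_eq_sgn_powr sgn_mult)
  ultimately show ?thesis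
    unfolding phi_eq_sgn_powr[of q "phi r x"] by (simp add: sgn_mult_abs)
qed simp

lemma continuous_on_phi:
  assumes "continuous_on S q" "continuous_on S f" and "\<And>x. x \<in> S \<Longrightarrow> q x > 1"
  shows "continuous_on S (\<lambda>x. phi (q x) (f x))"
proof -
  \<comment> \<open>Joint continuity in the exponent and the argument is delicate only where the argument
      changes sign; on the positive and negative parts it is that of powers of nonnegative
      numbers with positive exponents.\<close>
  have "phi r y = max y 0 powr (r - 1) - max (- y) 0 powr (r - 1)" for r y
    by (auto simp: phi_eq_sgn_powr sgn_if max_def)
  then show ?thesis
    using assms(3) by (auto intro!: continuous_intros continuous_on_powr' assms(1,2))
qed

text \<open>A bound on \<open>|x|\<close> to the power \<open>p t - 1\<close> bounds \<open>x\<close>, uniformly in \<open>t\<close>, because the exponents have a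
positive minimum \<open>m\<close> on the compact interval.\<close>

lemma phi_uniformly_coercive:
  fixes p :: "real \<Rightarrow> real"
  assumes "T > 0" and p: "continuous_on {0..T} p" "\<And>t. t \<in> {0..T} \<Longrightarrow> p t > 1"
  shows "\<exists>K>0. \<forall>t\<in>{0..T}. \<forall>x. \<bar>phi (p t) x\<bar> \<le> L \<longrightarrow> \<bar>x\<bar> \<le> K"
proof -
  obtain s where s: "s \<in> {0..T}" "\<And>t. t \<in> {0..T} \<Longrightarrow> p s \<le> p t"
    using continuous_attains_inf[OF compact_Icc _ p(1)] \<open>T > 0\<close> by auto
  define m where "m = p s - 1"
  have m: "m > 0" "\<And>t. t \<in> {0..T} \<Longrightarrow> m \<le> p t - 1" using s p(2)[OF s(1)] by (auto simp: m_def)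
  define K where "K = max 1 L powr (1 / m)"
  have "K \<ge> 1" using m by (simp add: K_def ge_one_powr_ge_zero)
  have "\<bar>x\<bar> \<le> K" if "t \<in> {0..T}" "\<bar>phi (p t) x\<bar> \<le> L" for t x
  proof (cases "\<bar>x\<bar> \<le> 1")
    case False
    have "\<bar>x\<bar> powr m \<le> \<bar>x\<bar> powr (p t - 1)" using False m(2)[OF that(1)] by (intro powr_mono) auto
    also have "\<dots> \<le> max 1 L" using that(2) by (simp add: abs_phi)
    finally have "(\<bar>x\<bar> powr m) powr (1 / m) \<le> K"
      unfolding K_def using m by (intro powr_mono2) auto
    then show ?thesis using m False by (simp add: powr_powr)
  qed (use \<open>K \<ge> 1\<close> in simp)
  then show ?thesis using \<open>K \<ge> 1\<close> by (intro exI[of _ K]) auto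
qed

section \<open>A priori bounds\<close>

lemma periodic_derivative_zero:
  fixes f :: "real \<Rightarrow> real"
  assumes "T > 0" and f: "\<And>t. t \<in> {0..T} \<Longrightarrow> (f has_real_derivative f' t) (at t within {0..T})"
    and "f T = f 0"
  obtains \<xi> where "\<xi> \<in> {0..T}" "f' \<xi> = 0"
proof -
  have "\<exists>z>0. z < T \<and> (*) (f' z) = (\<lambda>v. 0)"
  proof (rule Rolle_deriv[OF \<open>T > 0\<close>])
    show "continuous_on {0..T} f"
      by (rule DERIV_continuous_on[OF f])
    show "(f has_derivative (*) (f' x)) (at x)" if "0 < x" "x < T" for x
      using f[of x] that by (simp add: has_field_derivative_def at_within_Icc_at)
  qed (use \<open>f T = f 0\<close> in simp)
  then obtain z where "0 < z" "z < T" "(*) (f' z) = (\<lambda>v. 0)" by blast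
  then have "f' z * 1 = 0" by metis
  with \<open>0 < z\<close> \<open>z < T\<close> show thesis by (intro that[of z]) auto
qed

lemma continuous_has_antiderivative:
  fixes f :: "real \<Rightarrow> real"
  assumes "continuous_on UNIV f"
  shows "\<exists>F. \<forall>x. (F has_real_derivative f x) (at x)"
  using assms einterval_antiderivative[of "-\<infinity>" \<infinity> f]
  by (simp add: continuous_on_eq_continuous_at has_real_derivative_iff_has_vector_derivative)

text \<open>The energy estimate.  It is stated for \<open>w' = \<kappa>(u)\<close> with \<open>\<kappa>\<close> of the same sign as its argument, so
that it covers both the system itself, \<open>\<kappa>(x) = \<epsilon> x\<close>, and its cut-off version.  Multiply the equation
for \<open>phi (p t) (u' t)\<close> by \<open>u'\<close> and integrate: \<open>w u'\<close> integrates to minus the integral of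
\<open>\<kappa>(u) u\<close>, which is at most 0, and \<open>H(u) u'\<close> is the derivative of a periodic function.  What remains
on the right is at most \<open>M V\<close>, where \<open>V\<close> is the integral of \<open>|u'|\<close>.  On the left, coercivity gives
\<open>phi (p t) x * x \<ge> (M + 1) (|x| - K)\<close> pointwise; hence \<open>V \<le> (M + 1) K T\<close>.  Finally \<open>u\<close>
vanishes at a zero of \<open>w'\<close>, and its oscillation is at most \<open>V\<close>.\<close>

lemma energy_bound:
  fixes u u' w E H \<kappa> p :: "real \<Rightarrow> real"
  assumes "T > 0" "M \<ge> 0" "K \<ge> 0"
    and K: "\<And>t x. \<lbrakk>t \<in> {0..T}; \<bar>phi (p t) x\<bar> \<le> M + 1\<rbrakk> \<Longrightarrow> \<bar>x\<bar> \<le> K"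
    and E: "continuous_on {0..T} E" "\<And>t. t \<in> {0..T} \<Longrightarrow> \<bar>E t\<bar> \<le> M"
    and H: "continuous_on UNIV H" and \<kappa>: "continuous_on UNIV \<kappa>"
    and sgn: "\<And>x. 0 \<le> \<kappa> x * x" "\<And>x. \<kappa> x = 0 \<Longrightarrow> x = 0"
    and u: "\<And>t. t \<in> {0..T} \<Longrightarrow> (u has_real_derivative u' t) (at t within {0..T})"
    and u': "continuous_on {0..T} u'"
    and w: "\<And>t. t \<in> {0..T} \<Longrightarrow> (w has_real_derivative \<kappa> (u t)) (at t within {0..T})"
    and eq: "\<And>t. t \<in> {0..T} \<Longrightarrow> phi (p t) (u' t) = w t + E t - H (u t)"
    and per: "u T = u 0" "w T = w 0" and t: "t \<in> {0..T}"
  shows "\<bar>u t\<bar> \<le> (M + 1) * K * T"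
proof -
  have cu: "continuous_on {0..T} u" and cw: "continuous_on {0..T} w"
    by (rule DERIV_continuous_on[OF u] DERIV_continuous_on[OF w], assumption)+
  have cHu: "continuous_on {0..T} (\<lambda>t. H (u t))" and c\<kappa>u: "continuous_on {0..T} (\<lambda>t. \<kappa> (u t))"
    by (rule continuous_on_compose2[OF H cu] continuous_on_compose2[OF \<kappa> cu], simp)+
  note cont = cu cw cHu c\<kappa>u E(1) u'
  have ftc: "(f' has_integral (f T - f 0)) {0..T}"
    if "\<And>t. t \<in> {0..T} \<Longrightarrow> (f has_real_derivative f' t) (at t within {0..T})" for f f' :: "real \<Rightarrow> real"
    using that \<open>T > 0\<close>
    by (intro fundamental_theorem_of_calculus) (auto simp flip: has_real_derivative_iff_has_vector_derivative)
  define V where "V = integral {0..T} (\<lambda>t. \<bar>u' t\<bar>)"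
  have iV: "((\<lambda>t. \<bar>u' t\<bar>) has_integral V) {0..T}"
    unfolding V_def by (intro integrable_integral integrable_continuous_interval continuous_intros cont)
  \<comment> \<open>Integration by parts for the periodic product of w and u.\<close>
  have wu: "((\<lambda>t. \<kappa> (u t) * u t + u' t * w t) has_integral 0) {0..T}"
    using ftc[OF DERIV_mult[OF w u]] per by simp
  obtain G where G: "\<And>x. (G has_real_derivative H x) (at x)"
    using continuous_has_antiderivative[OF H] by blast
  have Hu: "((\<lambda>t. H (u t) * u' t) has_integral 0) {0..T}"
    using ftc[of "\<lambda>t. G (u t)" "\<lambda>t. H (u t) * u' t"] DERIV_chain2[OF G u] per by simp
  have "(M + 1) * V - (M + 1) * K * T \<le> M * V"
  proof (rule has_integral_le)
    show "((\<lambda>t. (M + 1) * \<bar>u' t\<bar> - (M + 1) * K) has_integral ((M + 1) * V - (M + 1) * K * T)) {0..T}"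
      using has_integral_diff[OF has_integral_mult_right[OF iV, of "M + 1"] has_integral_const_real[of "(M + 1) * K" 0 T]]
        \<open>T > 0\<close> by (simp add: mult.commute)
    show "((\<lambda>t. M * \<bar>u' t\<bar> + (\<kappa> (u t) * u t + u' t * w t) - H (u t) * u' t) has_integral (M * V)) {0..T}"
      using has_integral_diff[OF has_integral_add[OF has_integral_mult_right[OF iV, of M] wu] Hu] by simp
    fix t assume t: "t \<in> {0..T}"
    have "(M + 1) * \<bar>u' t\<bar> - (M + 1) * K \<le> \<bar>phi (p t) (u' t)\<bar> * \<bar>u' t\<bar>"
    proof (cases "\<bar>phi (p t) (u' t)\<bar> \<le> M + 1")
      case True
      have "(M + 1) * \<bar>u' t\<bar> \<le> (M + 1) * K" using K[OF t True] \<open>M \<ge> 0\<close> by (intro mult_left_mono) auto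
      moreover have "0 \<le> \<bar>phi (p t) (u' t)\<bar> * \<bar>u' t\<bar>" by simp
      ultimately show ?thesis by linarith
    next
      case False
      then have "(M + 1) * \<bar>u' t\<bar> \<le> \<bar>phi (p t) (u' t)\<bar> * \<bar>u' t\<bar>" by (intro mult_right_mono) auto
      moreover have "0 \<le> (M + 1) * K" using \<open>M \<ge> 0\<close> \<open>K \<ge> 0\<close> by simp
      ultimately show ?thesis by linarith
    qed
    also have "\<bar>phi (p t) (u' t)\<bar> * \<bar>u' t\<bar> = phi (p t) (u' t) * u' t"
      using phi_nonneg[of "u' t" "p t"] phi_nonpos[of "u' t" "p t"]
      by (cases "u' t \<ge> 0") auto
    also have "\<dots> = w t * u' t + E t * u' t - H (u t) * u' t"
      unfolding eq[OF t] by (simp add: algebra_simps)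
    also have "\<dots> \<le> M * \<bar>u' t\<bar> + (\<kappa> (u t) * u t + u' t * w t) - H (u t) * u' t"
    proof -
      have "E t * u' t \<le> \<bar>E t\<bar> * \<bar>u' t\<bar>" by (metis abs_ge_self abs_mult)
      also have "\<dots> \<le> M * \<bar>u' t\<bar>" using E(2)[OF t] by (intro mult_right_mono) auto
      finally show ?thesis using sgn(1)[of "u t"] by (simp add: mult.commute)
    qed
    finally show "(M + 1) * \<bar>u' t\<bar> - (M + 1) * K \<le> M * \<bar>u' t\<bar> + (\<kappa> (u t) * u t + u' t * w t) - H (u t) * u' t" .
  qed
  then have V: "V \<le> (M + 1) * K * T" by (simp add: algebra_simps)
  obtain \<xi> where \<xi>: "\<xi> \<in> {0..T}" "\<kappa> (u \<xi>) = 0"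
    using periodic_derivative_zero[OF \<open>T > 0\<close> w per(2)] by blast
  then have "u \<xi> = 0" using sgn(2) by blast
  have diff: "\<bar>u b - u a\<bar> \<le> V" if "0 \<le> a" "a \<le> b" "b \<le> T" for a b
  proof -
    have sub: "{a..b} \<subseteq> {0..T}" using that by auto
    have d: "(u' has_integral (u b - u a)) {a..b}"
    proof (rule fundamental_theorem_of_calculus[OF \<open>a \<le> b\<close>])
      fix x assume "x \<in> {a..b}"
      then show "(u has_vector_derivative u' x) (at x within {a..b})"
        using DERIV_subset[OF u sub] sub by (auto simp: has_real_derivative_iff_has_vector_derivative)
    qed
    have i: "(\<lambda>t. \<bar>u' t\<bar>) integrable_on {a..b}"
      by (rule integrable_on_subinterval[OF has_integral_integrable[OF iV] sub])
    have "\<bar>u b - u a\<bar> \<le> integral {a..b} (\<lambda>t. \<bar>u' t\<bar>)"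
      using integral_norm_bound_integral[OF has_integral_integrable[OF d] i] integral_unique[OF d] by simp
    also have "\<dots> \<le> V" unfolding V_def
      by (rule integral_subset_le[OF sub i has_integral_integrable[OF iV]]) auto
    finally show ?thesis .
  qed
  have "\<bar>u t\<bar> \<le> V"
    using diff[of t \<xi>] diff[of \<xi> t] t \<xi>(1) \<open>u \<xi> = 0\<close> by (cases "t \<le> \<xi>") auto
  with V show ?thesis by linarith
qed

lemma bound_from_point_and_slope:
  fixes w w' :: "real \<Rightarrow> real"
  assumes "T > 0"
    and w: "\<And>t. t \<in> {0..T} \<Longrightarrow> (w has_real_derivative w' t) (at t within {0..T})"
    and w': "\<And>t. t \<in> {0..T} \<Longrightarrow> \<bar>w' t\<bar> \<le> c"
    and "\<xi> \<in> {0..T}" "\<bar>w \<xi>\<bar> \<le> B" "t \<in> {0..T}"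
  shows "\<bar>w t\<bar> \<le> B + c * T"
proof -
  have "c \<ge> 0" using w'[OF \<open>\<xi> \<in> {0..T}\<close>] by linarith
  have "norm (w t - w \<xi>) \<le> c * norm (t - \<xi>)"
    by (rule field_differentiable_bound[OF convex_real_interval(5) w]) (use w' assms in auto)
  also have "\<dots> \<le> c * T"
    using assms \<open>c \<ge> 0\<close> by (intro mult_left_mono) auto
  finally show ?thesis using assms(5) by auto
qed

section \<open>The equivalent first-order system\<close>

lemma abs_continuous_on_subinterval:
  assumes "abs_continuous_on_interval a b f" "a \<le> c" "d \<le> b"
  shows "abs_continuous_on_interval c d f"
  unfolding abs_continuous_on_interval_def
proof (intro allI impI)
  fix \<eta> :: real assume "\<eta> > 0"
  with assms(1) obtain \<delta> where "\<delta> > 0" and \<delta>: "\<And>(n::nat) l r.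
       (\<forall>i<n. a \<le> l i \<and> l i \<le> r i \<and> r i \<le> b) \<and>
       disjoint_family_on (\<lambda>i. {l i<..<r i}) {..<n} \<and>
       (\<Sum>i<n. r i - l i) < \<delta> \<Longrightarrow> (\<Sum>i<n. \<bar>f (r i) - f (l i)\<bar>) < \<eta>"
    unfolding abs_continuous_on_interval_def by meson
  show "\<exists>\<delta>>0. \<forall>(n::nat) l r. (\<forall>i<n. c \<le> l i \<and> l i \<le> r i \<and> r i \<le> d) \<and>
       disjoint_family_on (\<lambda>i. {l i<..<r i}) {..<n} \<and> (\<Sum>i<n. r i - l i) < \<delta> \<longrightarrow>
       (\<Sum>i<n. \<bar>f (r i) - f (l i)\<bar>) < \<eta>"
    using \<open>\<delta> > 0\<close> \<delta> assms(2,3) by (meson order_trans)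
qed

lemma abs_continuous_on_add_const:
  assumes "abs_continuous_on_interval c d g" and fg: "\<And>t. t \<in> {c..d} \<Longrightarrow> f t = k + g t"
  shows "abs_continuous_on_interval c d f"
  unfolding abs_continuous_on_interval_def
proof (intro allI impI)
  fix \<eta> :: real assume "\<eta> > 0"
  with assms(1) obtain \<delta> where "\<delta> > 0" and \<delta>: "\<And>(n::nat) l r.
       (\<forall>i<n. c \<le> l i \<and> l i \<le> r i \<and> r i \<le> d) \<and>
       disjoint_family_on (\<lambda>i. {l i<..<r i}) {..<n} \<and>
       (\<Sum>i<n. r i - l i) < \<delta> \<Longrightarrow> (\<Sum>i<n. \<bar>g (r i) - g (l i)\<bar>) < \<eta>"
    unfolding abs_continuous_on_interval_def by meson
  show "\<exists>\<delta>>0. \<forall>(n::nat) l r. (\<forall>i<n. c \<le> l i \<and> l i \<le> r i \<and> r i \<le> d) \<and>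
       disjoint_family_on (\<lambda>i. {l i<..<r i}) {..<n} \<and> (\<Sum>i<n. r i - l i) < \<delta> \<longrightarrow>
       (\<Sum>i<n. \<bar>f (r i) - f (l i)\<bar>) < \<eta>"
  proof (intro exI conjI allI impI)
    fix n :: nat and l r :: "nat \<Rightarrow> real"
    assume lr: "(\<forall>i<n. c \<le> l i \<and> l i \<le> r i \<and> r i \<le> d) \<and>
       disjoint_family_on (\<lambda>i. {l i<..<r i}) {..<n} \<and> (\<Sum>i<n. r i - l i) < \<delta>"
    have "(\<Sum>i<n. \<bar>f (r i) - f (l i)\<bar>) = (\<Sum>i<n. \<bar>g (r i) - g (l i)\<bar>)"
    proof (rule sum.cong[OF refl])
      fix i assume "i \<in> {..<n}"
      with lr have "c \<le> l i" "l i \<le> r i" "r i \<le> d" by auto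
      then show "\<bar>f (r i) - f (l i)\<bar> = \<bar>g (r i) - g (l i)\<bar>" by (simp add: fg)
    qed
    with \<delta>[OF lr] show "(\<Sum>i<n. \<bar>f (r i) - f (l i)\<bar>) < \<eta>" by simp
  qed (rule \<open>\<delta> > 0\<close>)
qed

lemma C1T_has_derivative:
  assumes "T > 0" "u \<in> C1T T" "t \<in> {0..T}"
  shows "(u has_real_derivative ideriv T u t) (at t within {0..T})"
proof -
  have "u differentiable (at t within {0..T})"
    using assms by (auto simp: C1T_def differentiable_on_def)
  then show ?thesis
    unfolding ideriv_def has_real_derivative_iff_has_vector_derivative
    by (simp add: vector_derivative_works)
qed

lemma ideriv_eq:
  assumes "T > 0" "(u has_real_derivative d) (at t within {0..T})" "t \<in> {0..T}"
  shows "ideriv T u t = d"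
  unfolding ideriv_def
  using assms by (intro vector_derivative_within_closed_interval) (auto simp: has_real_derivative_iff_has_vector_derivative)

text \<open>On every interval \<open>[0, t]\<close> the fundamental theorem, applied to the absolutely continuous function
\<open>phi (p s) (u' s)\<close>, gives the integrated equation, that is \<open>w t = w 0\<close> plus \<open>\<epsilon>\<close> times the integral of
\<open>u\<close>.  As \<open>u\<close> is continuous, \<open>w\<close> is differentiable everywhere, not only almost everywhere.  That
\<open>w\<close> is periodic uses \<open>p 0 = p T\<close> and that \<open>e\<close> has integral 0.\<close>

lemma solution_imp_system:
  fixes T \<epsilon> :: real and p \<theta> \<Theta> e u :: "real \<Rightarrow> real"
  assumes "T > 0" and "p 0 = p T" and \<theta>: "continuous_on UNIV \<theta>"
    and e: "e integrable_on {0..T}" and e0: "integral {0..T} e = 0"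
    and \<Theta>: "\<And>x. (\<Theta> has_real_derivative \<theta> x) (at x)"
    and sol: "is_solution T p \<theta> e \<epsilon> u"
  defines "w \<equiv> \<lambda>t. phi (p t) (ideriv T u t) + \<Theta> (u t) - integral {0..t} e"
  shows "\<And>t. t \<in> {0..T} \<Longrightarrow> (w has_real_derivative \<epsilon> * u t) (at t within {0..T})"
    and "w T = w 0"
proof -
  have uC: "u \<in> C1T T" using sol by (simp add: is_solution_def)
  note u = C1T_has_derivative[OF \<open>T > 0\<close> uC]
  have cu: "continuous_on {0..T} u" by (rule DERIV_continuous_on[OF u])
  have cu': "continuous_on {0..T} (ideriv T u)" using uC by (simp add: C1T_def)
  show "w T = w 0" using uC e0 \<open>p 0 = p T\<close> by (simp add: w_def C1T_def)
  let ?f = "\<lambda>s. phi (p s) (ideriv T u s)"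
  define g where "g t = e t + \<epsilon> * u t - \<theta> (u t) * ideriv T u t" for t
  have "AE t in lebesgue. t \<in> {0..T} \<longrightarrow> (\<exists>d. (?f has_real_derivative d) (at t within {0..T}) \<and>
        d + \<theta> (u t) * ideriv T u t - \<epsilon> * u t = e t)"
    using sol by (simp add: is_solution_def)
  then obtain N where N: "negligible N" "{t. \<not> (t \<in> {0..T} \<longrightarrow> (\<exists>d. (?f has_real_derivative d) (at t within {0..T}) \<and>
        d + \<theta> (u t) * ideriv T u t - \<epsilon> * u t = e t))} \<subseteq> N"
    unfolding eventually_ae_filter_negligible by blast
  have fd: "(?f has_real_derivative g t) (at t within {0..T})" if tN: "t \<in> {0..T} - N" for t
  proof -
    obtain d where "(?f has_real_derivative d) (at t within {0..T})" "d + \<theta> (u t) * ideriv T u t - \<epsilon> * u t = e t"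
      using N(2) tN by blast
    moreover from this(2) have "d = g t" by (simp add: g_def)
    ultimately show ?thesis by simp
  qed
  have ac: "abs_continuous_on_interval 0 T ?f" using sol by (simp add: is_solution_def)
  have w_eq: "w t = w 0 + \<epsilon> * integral {0..t} u" if t: "t \<in> {0..T}" for t
  proof -
    have sub: "{0..t} \<subseteq> {0..T}" using t by auto
    have i1: "(g has_integral (?f t - ?f 0)) {0..t}"
    proof (rule FTC_abs_continuous[OF _ _ N(1)])
      show "0 \<le> t" using t by simp
      show "abs_continuous_on_interval 0 t ?f"
        by (rule abs_continuous_on_subinterval[OF ac]) (use t in auto)
      show "(?f has_real_derivative g x) (at x within {0..t})" if "x \<in> {0..t} - N" for x
        by (rule DERIV_subset[OF fd sub]) (use sub that in auto)
    qed
    have i2: "((\<lambda>t. \<theta> (u t) * ideriv T u t) has_integral (\<Theta> (u t) - \<Theta> (u 0))) {0..t}"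
    proof (rule fundamental_theorem_of_calculus)
      fix x assume "x \<in> {0..t}"
      then show "((\<lambda>t. \<Theta> (u t)) has_vector_derivative \<theta> (u x) * ideriv T u x) (at x within {0..t})"
        using DERIV_chain2[OF \<Theta> DERIV_subset[OF u sub, of x]] sub
        by (auto simp flip: has_real_derivative_iff_has_vector_derivative)
    qed (use t in simp)
    have i3: "((\<lambda>t. \<epsilon> * u t) has_integral (\<epsilon> * integral {0..t} u)) {0..t}"
      by (intro has_integral_mult_right integrable_integral integrable_continuous_interval
            continuous_on_subset[OF cu sub])
    have i4: "(e has_integral (integral {0..t} e)) {0..t}"
      by (intro integrable_integral integrable_on_subinterval[OF e sub])
    have "(g has_integral (integral {0..t} e + \<epsilon> * integral {0..t} u - (\<Theta> (u t) - \<Theta> (u 0)))) {0..t}"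
      unfolding g_def[abs_def] by (rule has_integral_diff[OF has_integral_add[OF i4 i3] i2])
    then have "?f t - ?f 0 = integral {0..t} e + \<epsilon> * integral {0..t} u - (\<Theta> (u t) - \<Theta> (u 0))"
      by (rule has_integral_unique[OF i1])
    then show ?thesis by (simp add: w_def)
  qed
  fix t assume t: "t \<in> {0..T}"
  have "((\<lambda>t. w 0 + \<epsilon> * integral {0..t} u) has_real_derivative \<epsilon> * u t) (at t within {0..T})"
    using DERIV_add[OF DERIV_const[of "w 0"] DERIV_cmult[OF integral_has_real_derivative[OF cu t], of \<epsilon>]]
    by simp
  then show "(w has_real_derivative \<epsilon> * u t) (at t within {0..T})"
    by (rule has_field_derivative_transform_within[OF _ zero_less_one t]) (rule w_eq[symmetric])
qed

text \<open>Along an orbit, \<open>phi (p t) (u' t)\<close> differs by a constant from the indefinite integral of the integrable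
function \<open>G = e + \<epsilon> u - \<theta>(u) u'\<close>; so it is absolutely continuous with derivative \<open>G\<close> almost
everywhere.\<close>

lemma system_imp_solution:
  fixes T \<epsilon> :: real and p \<theta> \<Theta> e u u' w :: "real \<Rightarrow> real"
  assumes "T > 0" and \<theta>: "continuous_on UNIV \<theta>" and e: "e absolutely_integrable_on {0..T}"
    and \<Theta>: "\<And>x. (\<Theta> has_real_derivative \<theta> x) (at x)"
    and u: "\<And>t. t \<in> {0..T} \<Longrightarrow> (u has_real_derivative u' t) (at t within {0..T})"
    and cu': "continuous_on {0..T} u'"
    and w: "\<And>t. t \<in> {0..T} \<Longrightarrow> (w has_real_derivative \<epsilon> * u t) (at t within {0..T})"
    and eq: "\<And>t. t \<in> {0..T} \<Longrightarrow> phi (p t) (u' t) = w t + integral {0..t} e - \<Theta> (u t)"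
    and per: "u T = u 0" "u' T = u' 0"
  shows "is_solution T p \<theta> e \<epsilon> u"
proof -
  have id: "ideriv T u t = u' t" if "t \<in> {0..T}" for t
    by (rule ideriv_eq[OF \<open>T > 0\<close> u that]) (rule that)
  have cu: "continuous_on {0..T} u" by (rule DERIV_continuous_on[OF u])
  have c\<theta>: "continuous_on {0..T} (\<lambda>t. \<theta> (u t))" by (rule continuous_on_compose2[OF \<theta> cu]) simp
  have uC: "u \<in> C1T T"
    unfolding C1T_def mem_Collect_eq
  proof (intro conjI)
    show "u differentiable_on {0..T}"
      using u unfolding differentiable_on_def differentiable_def has_field_derivative_def by blast
    show "continuous_on {0..T} (ideriv T u)"
      by (rule continuous_on_eq[OF cu']) (simp add: id)
    show "ideriv T u 0 = ideriv T u T" using id per \<open>T > 0\<close> by simp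
  qed (use per in simp)
  define G where "G t = e t + (\<epsilon> * u t - \<theta> (u t) * u' t)" for t
  have G: "G absolutely_integrable_on {0..T}"
    unfolding G_def
    by (intro set_integral_add e absolutely_integrable_continuous_real continuous_intros cu c\<theta> cu')
  then have Gi: "G integrable_on {0..T}" using set_lebesgue_integral_eq_integral(1) by blast
  let ?f = "\<lambda>s. phi (p s) (ideriv T u s)"
  have f_eq: "?f t = ?f 0 + integral {0..t} G" if t: "t \<in> {0..T}" for t
  proof -
    have sub: "{0..t} \<subseteq> {0..T}" using t by auto
    have "((\<lambda>t. \<epsilon> * u t - \<theta> (u t) * u' t) has_integral
            ((w t - \<Theta> (u t)) - (w 0 - \<Theta> (u 0)))) {0..t}"
    proof (rule fundamental_theorem_of_calculus)
      fix x assume "x \<in> {0..t}"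
      then have x: "x \<in> {0..T}" using sub by blast
      show "((\<lambda>t. w t - \<Theta> (u t)) has_vector_derivative \<epsilon> * u x - \<theta> (u x) * u' x) (at x within {0..t})"
        unfolding has_real_derivative_iff_has_vector_derivative[symmetric]
        by (rule DERIV_subset[OF DERIV_diff[OF w[OF x] DERIV_chain2[OF \<Theta> u[OF x]]] sub])
    qed (use t in simp)
    moreover have "(e has_integral integral {0..t} e) {0..t}"
      using e set_lebesgue_integral_eq_integral(1) integrable_on_subinterval[OF _ sub] by blast
    ultimately have "(G has_integral (integral {0..t} e + ((w t - \<Theta> (u t)) - (w 0 - \<Theta> (u 0))))) {0..t}"
      unfolding G_def by (intro has_integral_add)
    then have "integral {0..t} G = integral {0..t} e + ((w t - \<Theta> (u t)) - (w 0 - \<Theta> (u 0)))"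
      by (rule integral_unique)
    moreover have "?f 0 = w 0 - \<Theta> (u 0)" using eq[of 0] id[of 0] \<open>T > 0\<close> by simp
    ultimately show ?thesis using eq[OF t] id[OF t] by simp
  qed
  have "AE t in lebesgue. t \<in> {0..T} \<longrightarrow> (\<exists>d. (?f has_real_derivative d) (at t within {0..T}) \<and>
        d + \<theta> (u t) * ideriv T u t - \<epsilon> * u t = e t)"
    unfolding eventually_ae_filter_negligible
  proof (intro exI conjI)
    show "negligible {x \<in> {0..T}.
           \<not> ((\<lambda>y. integral {0..y} G) has_real_derivative G x) (at x within {0..T})}" (is "negligible ?N")
      by (rule indefinite_integral_has_derivative_ae[OF Gi])
    have "\<exists>d. (?f has_real_derivative d) (at t within {0..T}) \<and>
        d + \<theta> (u t) * ideriv T u t - \<epsilon> * u t = e t" if t: "t \<in> {0..T}" "t \<notin> ?N" for t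
    proof (intro exI[of _ "G t"] conjI)
      have "((\<lambda>y. ?f 0 + integral {0..y} G) has_real_derivative G t) (at t within {0..T})"
        using DERIV_add[OF DERIV_const[of "?f 0"], of "\<lambda>y. integral {0..y} G" "G t" t "{0..T}"] t by simp
      then show "(?f has_real_derivative G t) (at t within {0..T})"
        by (rule has_field_derivative_transform_within[OF _ zero_less_one t(1)]) (rule f_eq[symmetric])
    qed (simp add: G_def id[OF t(1)])
    then show "{t. \<not> (t \<in> {0..T} \<longrightarrow> (\<exists>d. (?f has_real_derivative d) (at t within {0..T}) \<and>
        d + \<theta> (u t) * ideriv T u t - \<epsilon> * u t = e t))} \<subseteq> ?N"
      by blast
  qed
  moreover have "abs_continuous_on_interval 0 T ?f"
    by (rule abs_continuous_on_add_const[OF abs_continuous_indefinite_integral[OF G]]) (rule f_eq)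
  ultimately show ?thesis using uC by (simp add: is_solution_def)
qed

text \<open>Here \<open>w\<close> is cut off at \<open>B\<close> and \<open>u\<close> at \<open>R\<close>.  The condition \<open>|H| + |E| \<le> L \<le> B\<close> makes
\<open>trunc B w + E - H(trunc R u)\<close>, and with it \<open>u'\<close>, nonnegative for \<open>w \<ge> B\<close> and nonpositive for
\<open>w \<le> -B\<close>, while \<open>w' u \<ge> 0\<close>.  The resulting field \<open>F\<close> is bounded because the inverse of \<open>phi (p t)\<close> maps bounded sets to
sets bounded uniformly in \<open>t\<close>.\<close>

theorem periodic_system_solution:
  fixes T \<epsilon> R B L :: real and p E H :: "real \<Rightarrow> real"
  assumes "T > 0" and p: "continuous_on {0..T} p" "\<And>t. t \<in> {0..T} \<Longrightarrow> p t > 1" "p 0 = p T"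
    and E: "continuous_on {0..T} E" "E T = E 0" and H: "continuous_on UNIV H"
    and "\<epsilon> \<ge> 0" "R \<ge> 0" "L \<ge> 0"
    and L: "\<And>t x. \<lbrakk>t \<in> {0..T}; \<bar>x\<bar> \<le> R\<rbrakk> \<Longrightarrow> \<bar>H x\<bar> + \<bar>E t\<bar> \<le> L" and "L \<le> B"
  obtains u u' w where
    "\<And>t. t \<in> {0..T} \<Longrightarrow> (u has_real_derivative u' t) (at t within {0..T})"
    "continuous_on {0..T} u'"
    "\<And>t. t \<in> {0..T} \<Longrightarrow> (w has_real_derivative \<epsilon> * trunc R (u t)) (at t within {0..T})"
    "\<And>t. t \<in> {0..T} \<Longrightarrow> phi (p t) (u' t) = trunc B (w t) + E t - H (trunc R (u t))"
    "u T = u 0" "w T = w 0" "u' T = u' 0"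
proof -
  \<comment> \<open>Times outside the interval are moved to its nearest end, which extends the coefficients
      continuously to all times.\<close>
  define tc where "tc t = max 0 (min T t)" for t
  have tc: "tc t \<in> {0..T}" "t \<in> {0..T} \<Longrightarrow> tc t = t" for t
    using \<open>T > 0\<close> by (auto simp: tc_def)
  define arg where "arg t x = trunc B (fst x) + E (tc t) - H (trunc R (snd x))" for t x
  define F where "F t x = (\<epsilon> * trunc R (snd x), phi (p (tc t) / (p (tc t) - 1)) (arg t x))" for t x
  have p1: "p (tc t) > 1" for t using p(2) tc by blast
  have conj: "(p (tc t) - 1) * (p (tc t) / (p (tc t) - 1) - 1) = 1" for t
    using p1[of t] by (simp add: field_simps)
  have inv: "phi (p (tc t)) (snd (F t x)) = arg t x" for t x
    unfolding F_def using phi_conjugate_inverse[OF conj] by simp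
  have "B \<ge> 0" using \<open>L \<ge> 0\<close> \<open>L \<le> B\<close> by simp
  have arg_le: "\<bar>arg t x\<bar> \<le> B + L" for t x
    using abs_trunc_le[OF \<open>B \<ge> 0\<close>, of "fst x"] L[OF tc(1)[of t] abs_trunc_le[OF \<open>R \<ge> 0\<close>, of "snd x"]]
    unfolding arg_def by linarith
  obtain K where "K > 0" and K: "\<forall>t\<in>{0..T}. \<forall>x. \<bar>phi (p t) x\<bar> \<le> B + L \<longrightarrow> \<bar>x\<bar> \<le> K"
    using phi_uniformly_coercive[OF \<open>T > 0\<close> p(1,2)] by blast
  have bd: "norm (F t x) \<le> \<epsilon> * R + K" for t x
  proof -
    have "\<bar>snd (F t x)\<bar> \<le> K" using K tc(1)[of t] inv[of t x] arg_le[of t x] by simp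
    moreover have "\<bar>fst (F t x)\<bar> \<le> \<epsilon> * R"
      using abs_trunc_le[OF \<open>R \<ge> 0\<close>, of "snd x"] \<open>\<epsilon> \<ge> 0\<close> by (simp add: F_def abs_mult mult_left_mono)
    ultimately show ?thesis
      using norm_Pair_le[of "fst (F t x)" "snd (F t x)"] by simp
  qed
  have cpt: "continuous_on UNIV (\<lambda>y::real \<times> real \<times> real. p (tc (fst y)))"
    and cEt: "continuous_on UNIV (\<lambda>y::real \<times> real \<times> real. E (tc (fst y)))"
    by (rule continuous_on_compose2[OF p(1)] continuous_on_compose2[OF E(1)],
        simp add: tc_def continuous_intros, use tc(1) in blast)+
  have cHt: "continuous_on UNIV (\<lambda>y::real \<times> real \<times> real. H (trunc R (snd (snd y))))"
    by (rule continuous_on_compose2[OF H]) (auto intro!: continuous_intros)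
  have cF: "continuous_on UNIV (\<lambda>(t, x). F t x)"
    unfolding F_def split_def arg_def
  proof (intro continuous_on_Pair continuous_on_phi)
    show "continuous_on UNIV (\<lambda>y::real \<times> real \<times> real. \<epsilon> * trunc R (snd (snd y)))"
      by (intro continuous_intros)
    show "continuous_on UNIV (\<lambda>y::real \<times> real \<times> real. p (tc (fst y)) / (p (tc (fst y)) - 1))"
      using p1 by (intro continuous_intros cpt) (simp add: less_imp_neq[symmetric])
    show "continuous_on UNIV (\<lambda>y::real \<times> real \<times> real. trunc B (fst (snd y)) + E (tc (fst y)) - H (trunc R (snd (snd y))))"
      by (intro continuous_intros cEt cHt)
    show "1 < p (tc (fst y)) / (p (tc (fst y)) - 1)" for y :: "real \<times> real \<times> real"
      using p1 by (simp add: field_simps)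
  qed
  have clB: "w \<le> -B \<Longrightarrow> trunc B w = -B" "B \<le> w \<Longrightarrow> trunc B w = B" for w
    using \<open>B \<ge> 0\<close> by (auto simp: trunc_def)
  have arg_sgn: "w \<le> -B \<Longrightarrow> arg t (w, u) \<le> 0" "B \<le> w \<Longrightarrow> arg t (w, u) \<ge> 0" for t w u
    using L[OF tc(1)[of t] abs_trunc_le[OF \<open>R \<ge> 0\<close>, of u]] \<open>L \<le> B\<close>
    by (auto simp: arg_def clB)
  obtain X where X: "continuous_on {0..T} X" "X T = X 0"
    "\<And>t. t \<in> {0..T} \<Longrightarrow> X t = X 0 + integral {0..t} (\<lambda>s. F s (X s))"
  proof (rule planar_periodic_solution[OF \<open>T > 0\<close> cF bd, of B])
    show "fst (F t (w, u)) \<le> 0" if "u \<le> -B" for t w u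
      using that \<open>B \<ge> 0\<close> \<open>R \<ge> 0\<close> \<open>\<epsilon> \<ge> 0\<close> by (simp add: F_def trunc_def mult_nonneg_nonpos)
    show "fst (F t (w, u)) \<ge> 0" if "B \<le> u" for t w u
      using that \<open>B \<ge> 0\<close> \<open>R \<ge> 0\<close> \<open>\<epsilon> \<ge> 0\<close> by (simp add: F_def trunc_def)
    show "snd (F t (w, u)) \<le> 0" if "w \<le> -B" for t w u
      using phi_nonpos[OF arg_sgn(1)[OF that]] by (simp add: F_def)
    show "snd (F t (w, u)) \<ge> 0" if "B \<le> w" for t w u
      using phi_nonneg[OF arg_sgn(2)[OF that]] by (simp add: F_def)
  qed (rule that)
  have cFX: "continuous_on {0..T} (\<lambda>s. F s (X s))"
  proof -
    have "continuous_on {0..T} (\<lambda>s. (s, X s))" by (intro continuous_intros X(1))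
    from continuous_on_compose2[OF cF this] show ?thesis by simp
  qed
  have dX: "(X has_vector_derivative F t (X t)) (at t within {0..T})" if t: "t \<in> {0..T}" for t
  proof -
    have D: "((\<lambda>t. X 0 + integral {0..t} (\<lambda>s. F s (X s))) has_vector_derivative 0 + F t (X t)) (at t within {0..T})"
      by (intro has_vector_derivative_add has_vector_derivative_const integral_has_vector_derivative[OF cFX t])
    have "(X has_vector_derivative 0 + F t (X t)) (at t within {0..T})"
      by (rule has_vector_derivative_transform[OF t _ D]) (rule X(3))
    then show ?thesis by (simp only: add_0)
  qed
  show thesis
  proof (rule that[of "\<lambda>t. snd (X t)" "\<lambda>t. snd (F t (X t))" "\<lambda>t. fst (X t)"])
    fix t assume t: "t \<in> {0..T}"
    show "((\<lambda>t. snd (X t)) has_real_derivative snd (F t (X t))) (at t within {0..T})"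
      "((\<lambda>t. fst (X t)) has_real_derivative \<epsilon> * trunc R (snd (X t))) (at t within {0..T})"
      using bounded_linear.has_vector_derivative[OF bounded_linear_snd dX[OF t]]
        bounded_linear.has_vector_derivative[OF bounded_linear_fst dX[OF t]]
      by (simp_all add: has_real_derivative_iff_has_vector_derivative F_def)
    show "phi (p t) (snd (F t (X t))) = trunc B (fst (X t)) + E t - H (trunc R (snd (X t)))"
      using inv[of t "X t"] tc(2)[OF t] by (simp add: arg_def)
  next
    show "continuous_on {0..T} (\<lambda>t. snd (F t (X t)))" by (intro continuous_on_snd cFX)
    show "snd (F T (X T)) = snd (F 0 (X 0))"
      using X(2) p(3) E(2) \<open>T > 0\<close> by (simp add: F_def arg_def tc_def)
  qed (use X(2) in simp_all)
qed

section \<open>Existence and uniform bounds\<close>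

theorem theorem2p4:
  fixes T :: real and p \<theta> e :: "real \<Rightarrow> real"
  assumes "T > 0"
    and "continuous_on {0..T} p" and "\<And>t. t \<in> {0..T} \<Longrightarrow> p t > 1" and "p 0 = p T"
    and "continuous_on UNIV \<theta>"
    and "e absolutely_integrable_on {0..T}" and "(LINT t:{0..T}|lebesgue. e t) = 0"
  shows "\<forall>\<epsilon>star>0. \<exists>R>0. \<forall>\<epsilon>\<in>{0<..\<epsilon>star}.
           (\<exists>u\<in>C1T_ball T R. is_solution T p \<theta> e \<epsilon> u) \<and>
           (\<forall>u. is_solution T p \<theta> e \<epsilon> u \<longrightarrow> u \<in> C1T_ball T R \<and> mean T u = 0)"
proof (intro allI impI)
  fix \<epsilon>star :: real assume "\<epsilon>star > 0"
  note T = \<open>T > 0\<close> and p = assms(2,3,4) and \<theta> = assms(5) and e = assms(6)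
  have ei: "e integrable_on {0..T}" using e set_lebesgue_integral_eq_integral(1) by blast
  have e0: "integral {0..T} e = 0" using assms(7) set_lebesgue_integral_eq_integral(2)[OF e] by simp
  obtain \<Theta> where \<Theta>: "\<And>x. (\<Theta> has_real_derivative \<theta> x) (at x)"
    using continuous_has_antiderivative[OF \<theta>] by blast
  have c\<Theta>: "continuous_on S \<Theta>" for S
    using \<Theta> DERIV_isCont by (auto intro!: continuous_at_imp_continuous_on)
  define E where "E t = integral {0..t} e" for t
  have cE: "continuous_on {0..T} E"
    unfolding E_def by (rule indefinite_integral_continuous_1[OF ei])
  have ET: "E T = E 0" by (simp add: E_def e0)
  obtain M0 where M0: "\<forall>y\<in>E ` {0..T}. norm y \<le> M0"
    using compact_imp_bounded[OF compact_continuous_image[OF cE compact_Icc]] bounded_iff by blast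
  define M where "M = \<bar>M0\<bar>"
  have M: "M \<ge> 0" "\<And>t. t \<in> {0..T} \<Longrightarrow> \<bar>E t\<bar> \<le> M" using M0 by (force simp: M_def)+
  obtain K1 where "K1 > 0" and K1: "\<forall>t\<in>{0..T}. \<forall>x. \<bar>phi (p t) x\<bar> \<le> M + 1 \<longrightarrow> \<bar>x\<bar> \<le> K1"
    using phi_uniformly_coercive[OF T p(1,2)] by blast
  \<comment> \<open>The bound of the energy estimate for u.\<close>
  define R0 where "R0 = (M + 1) * K1 * T"
  have "R0 > 0" using M(1) \<open>K1 > 0\<close> T by (simp add: R0_def)
  obtain Q0 where Q0: "\<forall>y\<in>\<Theta> ` {-R0..R0}. norm y \<le> Q0"
    using compact_imp_bounded[OF compact_continuous_image[OF c\<Theta> compact_Icc]] bounded_iff by blast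
  define Q where "Q = \<bar>Q0\<bar>"
  have "\<bar>\<Theta> x\<bar> \<le> Q" if "\<bar>x\<bar> \<le> R0" for x
    using bspec[OF Q0 imageI[of x]] that by (simp add: Q_def abs_le_iff)
  then have Q: "Q \<ge> 0" "\<And>x. \<bar>x\<bar> \<le> R0 \<Longrightarrow> \<bar>\<Theta> x\<bar> \<le> Q" by (auto simp: Q_def)
  \<comment> \<open>The bound for w: at most M + Q where the derivative of u vanishes, plus the variation of w
      over a period.  The strict inequality M + Q < B below lets the cut-off of w at B be undone
      at that point.\<close>
  define B where "B = M + Q + \<epsilon>star * R0 * T"
  have "M + Q < B" using \<open>\<epsilon>star > 0\<close> \<open>R0 > 0\<close> T by (simp add: B_def)
  \<comment> \<open>The resulting bound for the derivative of u.\<close>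
  obtain K2 where "K2 > 0" and K2: "\<forall>t\<in>{0..T}. \<forall>x. \<bar>phi (p t) x\<bar> \<le> B + M + Q \<longrightarrow> \<bar>x\<bar> \<le> K2"
    using phi_uniformly_coercive[OF T p(1,2)] by blast
  define R where "R = R0 + K2 + 1"
  show "\<exists>R>0. \<forall>\<epsilon>\<in>{0<..\<epsilon>star}.
           (\<exists>u\<in>C1T_ball T R. is_solution T p \<theta> e \<epsilon> u) \<and>
           (\<forall>u. is_solution T p \<theta> e \<epsilon> u \<longrightarrow> u \<in> C1T_ball T R \<and> mean T u = 0)"
  proof (intro exI[of _ R] conjI ballI)
    show "R > 0" using \<open>R0 > 0\<close> \<open>K2 > 0\<close> by (simp add: R_def)
    fix \<epsilon> assume "\<epsilon> \<in> {0<..\<epsilon>star}"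
    then have \<epsilon>: "\<epsilon> > 0" "\<epsilon> \<le> \<epsilon>star" by auto
    have \<epsilon>B: "M + Q + \<epsilon> * R0 * T \<le> B"
      using \<epsilon> \<open>R0 > 0\<close> T by (simp add: B_def mult_right_mono)
    have apriori: "u \<in> C1T_ball T R \<and> mean T u = 0" if sol: "is_solution T p \<theta> e \<epsilon> u" for u
    proof -
      have uC: "u \<in> C1T T" using sol by (simp add: is_solution_def)
      note u = C1T_has_derivative[OF T uC]
      have cu: "continuous_on {0..T} u" by (rule DERIV_continuous_on[OF u])
      have uT: "u T = u 0" and cu': "continuous_on {0..T} (ideriv T u)"
        using uC by (auto simp: C1T_def)
      define w where "w t = phi (p t) (ideriv T u t) + \<Theta> (u t) - integral {0..t} e" for t
      have w: "(w has_real_derivative \<epsilon> * u t) (at t within {0..T})" if "t \<in> {0..T}" for t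
        unfolding w_def by (rule solution_imp_system(1)[OF T p(3) \<theta> ei e0 \<Theta> sol that])
      have wT: "w T = w 0"
        unfolding w_def by (rule solution_imp_system(2)[OF T p(3) \<theta> ei e0 \<Theta> sol])
      have eq: "phi (p t) (ideriv T u t) = w t + E t - \<Theta> (u t)" for t
        by (simp add: w_def E_def)
      have u_le: "\<bar>u t\<bar> \<le> R0" if "t \<in> {0..T}" for t
        unfolding R0_def
      proof (rule energy_bound[where \<kappa> = "(*) \<epsilon>" and u = u and w = w and E = E and H = \<Theta>
            and u' = "ideriv T u" and p = p, OF T M(1) _ _ cE M(2) c\<Theta> _ _ _ u cu' w eq uT wT that])
        show "\<bar>x\<bar> \<le> K1" if "t \<in> {0..T}" "\<bar>phi (p t) x\<bar> \<le> M + 1" for t x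
          using K1 that by blast
        show "0 \<le> \<epsilon> * x * x" for x using \<epsilon>(1) by (simp add: mult.assoc)
        show "x = 0" if "\<epsilon> * x = 0" for x using \<epsilon>(1) that by simp
      qed (use \<open>K1 > 0\<close> in \<open>auto intro!: continuous_intros\<close>)
      obtain \<xi> where \<xi>: "\<xi> \<in> {0..T}" "ideriv T u \<xi> = 0"
        using periodic_derivative_zero[OF T u uT] by blast
      have "\<bar>w \<xi>\<bar> \<le> M + Q"
        using eq[of \<xi>] \<xi> M(2)[OF \<xi>(1)] Q(2)[OF u_le[OF \<xi>(1)]] by simp
      then have w_le: "\<bar>w t\<bar> \<le> M + Q + (\<epsilon> * R0) * T" if "t \<in> {0..T}" for t
        using bound_from_point_and_slope[OF T w _ \<xi>(1) _ that, of "\<epsilon> * R0" "M + Q"] u_le \<epsilon>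
        by (simp add: abs_mult)
      have u'_le: "\<bar>ideriv T u t\<bar> \<le> K2" if t: "t \<in> {0..T}" for t
      proof -
        have "\<bar>phi (p t) (ideriv T u t)\<bar> \<le> B + M + Q"
          unfolding eq using w_le[OF t] M(2)[OF t] Q(2)[OF u_le[OF t]] \<epsilon>B by linarith
        then show ?thesis using K2 t by blast
      qed
      have "C1T_norm T u \<le> R0 + K2"
        unfolding C1T_norm_def using T u_le u'_le by (intro add_mono cSUP_least) auto
      then have "u \<in> C1T_ball T R" using uC by (simp add: C1T_ball_def R_def)
      moreover have "mean T u = 0"
      proof -
        have "((\<lambda>t. \<epsilon> * u t) has_integral (w T - w 0)) {0..T}"
          using w T by (intro fundamental_theorem_of_calculus)
            (auto simp flip: has_real_derivative_iff_has_vector_derivative)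
        then have "\<epsilon> * integral {0..T} u = 0" using wT by (simp add: integral_unique flip: integral_mult_right)
        then have "integral {0..T} u = 0" using \<epsilon> by simp
        then show ?thesis
          unfolding mean_def
          using set_lebesgue_integral_eq_integral(2)[OF absolutely_integrable_continuous_real[OF cu]] by simp
      qed
      ultimately show ?thesis ..
    qed
    show "\<forall>u. is_solution T p \<theta> e \<epsilon> u \<longrightarrow> u \<in> C1T_ball T R \<and> mean T u = 0"
      using apriori by blast
    obtain u u' w where
      u: "\<And>t. t \<in> {0..T} \<Longrightarrow> (u has_real_derivative u' t) (at t within {0..T})"
      and cu': "continuous_on {0..T} u'"
      and w: "\<And>t. t \<in> {0..T} \<Longrightarrow> (w has_real_derivative \<epsilon> * trunc R0 (u t)) (at t within {0..T})"
      and eq: "\<And>t. t \<in> {0..T} \<Longrightarrow> phi (p t) (u' t) = trunc B (w t) + E t - \<Theta> (trunc R0 (u t))"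
      and per: "u T = u 0" "w T = w 0" "u' T = u' 0"
    proof (rule periodic_system_solution[OF T p cE ET c\<Theta>, of \<epsilon> R0 "M + Q" B])
      show "\<bar>\<Theta> x\<bar> + \<bar>E t\<bar> \<le> M + Q" if "t \<in> {0..T}" "\<bar>x\<bar> \<le> R0" for t x
        using M(2)[OF that(1)] Q(2)[OF that(2)] by linarith
    qed (use \<epsilon> \<open>R0 > 0\<close> M(1) Q(1) \<open>M + Q < B\<close> in auto)
    have clR: "\<bar>trunc R0 z\<bar> \<le> R0" for z using \<open>R0 > 0\<close> by (simp add: abs_trunc_le)
    obtain \<xi> where \<xi>: "\<xi> \<in> {0..T}" "u' \<xi> = 0"
      using periodic_derivative_zero[OF T u per(1)] by blast
    \<comment> \<open>First the cut-off of w is shown to be inactive; the energy estimate then applies and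
        removes that of u.\<close>
    have "0 = trunc B (w \<xi>) + E \<xi> - \<Theta> (trunc R0 (u \<xi>))"
      using eq[OF \<xi>(1)] by (simp only: \<xi>(2) phi_0)
    moreover have "\<bar>x\<bar> \<le> M + Q" if "0 = x + E \<xi> - y" "\<bar>y\<bar> \<le> Q" for x y
      using that M(2)[OF \<xi>(1)] by linarith
    ultimately have "\<bar>trunc B (w \<xi>)\<bar> \<le> M + Q"
      using Q(2)[OF clR[of "u \<xi>"]] by blast
    then have "\<bar>w \<xi>\<bar> \<le> M + Q" using \<open>M + Q < B\<close> by (auto simp: trunc_def max_def min_def split: if_splits)
    then have "\<bar>w t\<bar> \<le> M + Q + (\<epsilon> * R0) * T" if "t \<in> {0..T}" for t
      using bound_from_point_and_slope[OF T w _ \<xi>(1) _ that, of "\<epsilon> * R0" "M + Q"] clR \<epsilon>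
      by (simp add: abs_mult)
    then have clw: "trunc B (w t) = w t" if "t \<in> {0..T}" for t
      using \<epsilon>B that by (intro trunc_id) force
    have u_le: "\<bar>u t\<bar> \<le> R0" if "t \<in> {0..T}" for t
      unfolding R0_def
    proof (rule energy_bound[where \<kappa> = "\<lambda>z. \<epsilon> * trunc R0 z" and u = u and w = w and E = E and
          H = "\<lambda>z. \<Theta> (trunc R0 z)" and u' = u' and p = p, OF T M(1) _ _ cE M(2)])
      show "continuous_on UNIV (\<lambda>z. \<Theta> (trunc R0 z))"
        by (rule continuous_on_compose2[OF c\<Theta>[of UNIV]]) (auto intro!: continuous_intros)
      show "continuous_on UNIV (\<lambda>z. \<epsilon> * trunc R0 z)" by (intro continuous_intros)
      show "0 \<le> \<epsilon> * trunc R0 x * x" for x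
        using \<epsilon> \<open>R0 > 0\<close> by (cases "x \<ge> 0") (auto simp: trunc_def max_def min_def mult_nonpos_nonpos mult_nonneg_nonpos)
      show "\<epsilon> * trunc R0 x = 0 \<Longrightarrow> x = 0" for x
        using \<epsilon> \<open>R0 > 0\<close> by (auto simp: trunc_def max_def min_def split: if_splits)
      show "phi (p t) (u' t) = w t + E t - \<Theta> (trunc R0 (u t))" if "t \<in> {0..T}" for t
        using eq[OF that] clw[OF that] by simp
    qed (use K1 \<open>K1 > 0\<close> u cu' w per that in auto)
    then have clu: "trunc R0 (u t) = u t" if "t \<in> {0..T}" for t
      using that by (intro trunc_id)
    have sol: "is_solution T p \<theta> e \<epsilon> u"
    proof (rule system_imp_solution[OF T \<theta> e \<Theta> u cu' _ _ per(1,3)])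
      show "(w has_real_derivative \<epsilon> * u t) (at t within {0..T})" if "t \<in> {0..T}" for t
        using w[OF that] clu[OF that] by simp
      show "phi (p t) (u' t) = w t + integral {0..t} e - \<Theta> (u t)" if "t \<in> {0..T}" for t
        using eq[OF that] clw[OF that] clu[OF that] by (simp add: E_def)
    qed
    with apriori show "\<exists>u\<in>C1T_ball T R. is_solution T p \<theta> e \<epsilon> u" by blast
  qed
qed

end
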